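(* Let $p$ be a prime and $P$ a $p$-group of order at most $p^6$. Then $\mathcal{CD}(P)$ is a chain of length 2 if and only if $p \neq 2$, $|P| = p^6$, $|\mathrm{Z}(P)| = p^2$, $|P'| = p^3$, and there exists an abelian normal subgroup $A$ of $P$ with $|A| = p^4$ and $[A,x] = \mathrm{Z}(P)$ for all $x \in P \setminus A$. In this case, $\mathcal{CD}(P) = \{\mathrm{Z}(P), A, P\}$.
   Context: For a finite group $G$ and a subgroup $U \le G$, the Chermak-Delgado measure of $U$ in $G$ is $m_G(U) = |U|\,|C_G(U)|$. Put $m(G) = \max\{m_G(U) \mid U \le G\}$ and $\mathcal{CD}(G) = \{U \le G \mid m_G(U) = m(G)\}$, the Chermak-Delgado lattice of $G$. A chain of length $n$ is a series of subgroups $G_0 < G_1 < \dots < G_n$ with proper inclusions (so it has exactly $n+1$ members). $\mathrm{Z}(P)$ denotes the center of $P$, $P'$ its commutator subgroup, and $[A,x]$ the subgroup generated by the commutators $[a,x]$ with $a \in A$. *)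

theory Defs
  imports "HOL-Algebra.Algebra"
begin

definition centralizer :: "('a, 'b) monoid_scheme \<Rightarrow> 'a set \<Rightarrow> 'a set" where
  "centralizer G U = {g \<in> carrier G. \<forall>u \<in> U. g \<otimes>\<^bsub>G\<^esub> u = u \<otimes>\<^bsub>G\<^esub> g}"

definition center :: "('a, 'b) monoid_scheme \<Rightarrow> 'a set" where
  "center G = {z \<in> carrier G. \<forall>g \<in> carrier G. z \<otimes>\<^bsub>G\<^esub> g = g \<otimes>\<^bsub>G\<^esub> z}"

(* The commutator convention [a, x] = a x a^-1 x^-1 is the one of derived. *)
definition commutator_elt :: "('a, 'b) monoid_scheme \<Rightarrow> 'a set \<Rightarrow> 'a \<Rightarrow> 'a set" where
  "commutator_elt G A x =
     generate G {a \<otimes>\<^bsub>G\<^esub> x \<otimes>\<^bsub>G\<^esub> inv\<^bsub>G\<^esub> a \<otimes>\<^bsub>G\<^esub> inv\<^bsub>G\<^esub> x | a. a \<in> A}"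

definition CD_measure :: "('a, 'b) monoid_scheme \<Rightarrow> 'a set \<Rightarrow> nat" where
  "CD_measure G U = card U * card (centralizer G U)"

(* Meaningful for finite G only: otherwise Max may range over an infinite set. *)
definition max_CD_measure :: "('a, 'b) monoid_scheme \<Rightarrow> nat" where
  "max_CD_measure G = Max {CD_measure G U | U. subgroup U G}"

definition CD_lattice :: "('a, 'b) monoid_scheme \<Rightarrow> 'a set set" where
  "CD_lattice G = {U. subgroup U G \<and> CD_measure G U = max_CD_measure G}"

definition chain_of_length :: "('a, 'b) monoid_scheme \<Rightarrow> nat \<Rightarrow> 'a set set \<Rightarrow> bool" where
  "chain_of_length G n \<C> \<longleftrightarrow>
     (\<exists>H :: nat \<Rightarrow> 'a set. (\<forall>i \<le> n. subgroup (H i) G) \<and> (\<forall>i < n. H i \<subset> H (Suc i)) \<and>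
        \<C> = H ` {..n})"

definition central_commutator_subgroup :: "('a, 'b) monoid_scheme \<Rightarrow> nat \<Rightarrow> 'a set \<Rightarrow> bool" where
  "central_commutator_subgroup P p A \<longleftrightarrow>
     A \<lhd> P \<and> comm_group (P\<lparr>carrier := A\<rparr>) \<and> card A = p ^ 4 \<and>
     (\<forall>x \<in> carrier P - A. commutator_elt P A x = center P)"

end

theory Submission
  imports Defs
begin

text \<open>Write $Z$ for the centre and $C$ for centralizers. If the commutator conditions hold, counting
  $a \mapsto [a, x]$ gives $C_A(x) = Z$ for $x \notin A$, hence $C(a) = A$ for $a \in A \setminus Z$.
  A subgroup $U$ of measure at least $p^8$ is then $Z$, $A$ or $P$, unless $U$ and $C(U)$ both meet $A$ in $Z$ and
  cover $P / A$; but then $P = UA = C(U)A$ and $P' \leq Z$, contradicting $|P'| = p^3$.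

  Conversely, let the lattice be a chain of length 2. Taking centralizers reverses it, so its members are
  $Z(M) < A < M$ with $A$ self-centralizing, and one may argue in $M$. Every abelian subgroup of order at least
  $|A|$ lies in $A$, and every noncentral element has at least $p^2$ conjugates; applied to an
  element of $A \setminus Z$ which is central modulo $Z$, this gives $|Z| \geq p^2$, which forces $|M| = p^6$ and
  $M = P$. Now $P' \leq A$, so conjugation by elements of $P$ induces commuting maps on $A$, and a
  counting argument in $A / Z$ yields $[A, P] \leq Z$. The remaining conditions follow from the structure of $P / Z$,
  a group of order $p^4$ in which $A / Z$ is central of index $p^2$.\<close>

section \<open>Commutators, centralizers and cosets\<close>

text \<open>The bound p^6 enters through exponents. Write |A| = p^m, |Z(M)| = p^z and |M| = p^k.
  Equality of the measures of A and M gives 2m = k + z, and the two size estimates are m >= z + 2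
  and z >= 2. Hence k = 2m - z >= z + 4 >= 6, so p^6 is the smallest order possible and k <= 6
  leaves only k = 6, m = 4, z = 2.

  The estimates rest on test subgroups generated by the centre and one or two elements. Such a
  subgroup has the same centralizer as its new generators. If it were too large, its measure would
  reach the maximum, and only three subgroups may do that.

  The measure sees centralizers in P but not commutators modulo Z. The bridge is an element b of A
  outside Z that is central modulo Z: its conjugacy class has at most |Z| elements, which yields
  both z >= 2 and, through the map g to [g, b], the inclusion of P' in A.

  In the converse, p^8 is the common measure |A|^2 = |P||Z| of the three members.\<close>

lemma (in group_hom) subgroup_preimage:
  assumes "subgroup K H" shows "subgroup {g \<in> carrier G. h g \<in> K} G"
  using assms by (intro subgroup.intro)
    (auto simp: subgroup.m_closed subgroup.one_closed subgroup.m_inv_closed)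

context group
begin

lemma inv_l_cancel: "\<lbrakk>x \<in> carrier G; y \<in> carrier G\<rbrakk> \<Longrightarrow> inv x \<otimes> (x \<otimes> y) = y"
  by (metis inv_closed l_inv l_one m_assoc)

lemma inv_r_cancel: "\<lbrakk>x \<in> carrier G; y \<in> carrier G\<rbrakk> \<Longrightarrow> x \<otimes> (inv x \<otimes> y) = y"
  by (metis inv_closed r_inv l_one m_assoc)

text \<open>Normalizes words: products associate to the right, inverses move to single letters and
  neighbours cancel. This settles identities that hold in every free group.\<close>

lemmas free_simps = m_assoc inv_mult_group inv_l_cancel inv_r_cancel

abbreviation commutator where
  "commutator x y \<equiv> x \<otimes> y \<otimes> inv x \<otimes> inv y"

lemma commutator_eq_one_iff:
  assumes "x \<in> carrier G" "y \<in> carrier G"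
  shows "commutator x y = \<one> \<longleftrightarrow> x \<otimes> y = y \<otimes> x"
proof -
  have "commutator x y = (x \<otimes> y) \<otimes> inv (y \<otimes> x)"
    using assms by (simp add: free_simps)
  then show ?thesis
    using assms by (metis inv_closed inv_equality inv_inv m_closed r_inv)
qed

text \<open>The commutator is the conjugate of \<open>x\<close> by \<open>g\<close> times the fixed
  factor \<open>inv x\<close>. Hence commutators with \<open>x\<close> and conjugates of
  \<open>x\<close> have the same fibres, namely the left cosets of the centralizer of
  \<open>x\<close>.\<close>

lemma commutator_eq_iff:
  assumes "g \<in> carrier G" "h \<in> carrier G" "x \<in> carrier G"
  shows "commutator g x = commutator h x \<longleftrightarrow> (inv g \<otimes> h) \<otimes> x = x \<otimes> (inv g \<otimes> h)"
proof -
  have "commutator g x = commutator h x \<longleftrightarrow> g \<otimes> x \<otimes> inv g = h \<otimes> x \<otimes> inv h"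
    using assms by simp
  also have "\<dots> \<longleftrightarrow> inv g \<otimes> (g \<otimes> x \<otimes> inv g) \<otimes> h = inv g \<otimes> (h \<otimes> x \<otimes> inv h) \<otimes> h"
    using assms by (metis inv_closed m_closed l_cancel r_cancel)
  also have "\<dots> \<longleftrightarrow> x \<otimes> (inv g \<otimes> h) = (inv g \<otimes> h) \<otimes> x"
    using assms by (simp add: free_simps)
  finally show ?thesis by auto
qed

lemma conj_eq_iff:
  assumes "g \<in> carrier G" "h \<in> carrier G" "x \<in> carrier G"
  shows "g \<otimes> x \<otimes> inv g = h \<otimes> x \<otimes> inv h \<longleftrightarrow> (inv g \<otimes> h) \<otimes> x = x \<otimes> (inv g \<otimes> h)"
  using commutator_eq_iff[OF assms] assms by simp

text \<open>Covers orbit-stabiliser and the first isomorphism theorem at once, without forming either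
  an action or a quotient.\<close>

lemma card_image_times_subgroup:
  assumes fin: "finite K" and K: "subgroup K G" and H: "subgroup H G" "H \<subseteq> K"
    and f: "\<And>g h. g \<in> K \<Longrightarrow> h \<in> K \<Longrightarrow> f g = f h \<longleftrightarrow> inv g \<otimes> h \<in> H"
  shows "card (f ` K) * card H = card K"
proof -
  have Kc: "g \<in> carrier G" if "g \<in> K" for g using K that by (rule subgroup.mem_carrier)
  have fibre: "card {h \<in> K. f h = f g} = card H" if g: "g \<in> K" for g
  proof -
    have "{h \<in> K. f h = f g} = (\<lambda>u. g \<otimes> u) ` H"
    proof safe
      fix h assume h: "h \<in> K" "f h = f g"
      then have "inv g \<otimes> h \<in> H" using f[OF g h(1)] by simp
      moreover have "h = g \<otimes> (inv g \<otimes> h)" using g h Kc by (simp add: inv_r_cancel)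
      ultimately show "h \<in> (\<lambda>u. g \<otimes> u) ` H" by blast
    next
      fix u assume u: "u \<in> H"
      then show gu: "g \<otimes> u \<in> K" using g H K by (blast intro: subgroup.m_closed)
      have "inv g \<otimes> (g \<otimes> u) \<in> H" using u g H Kc by (auto simp: inv_l_cancel)
      then show "f (g \<otimes> u) = f g" using f[OF g gu] by simp
    qed
    moreover have "inj_on (\<lambda>u. g \<otimes> u) H"
      using g H Kc by (intro inj_onI) (metis l_cancel subsetD)
    ultimately show ?thesis by (simp add: card_image)
  qed
  have "card K = (\<Sum>y\<in>f ` K. card {h \<in> K. f h = y})"
    using sum.image_gen[OF fin, of "\<lambda>_. 1::nat" f] by simp
  also have "\<dots> = (\<Sum>y\<in>f ` K. card H)"
    using fibre by (intro sum.cong) auto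
  finally show ?thesis by simp
qed

lemma card_dvd_subgroup:
  assumes "finite K" "subgroup K G" "subgroup H G" "H \<subseteq> K"
  shows "card H dvd card K"
proof -
  interpret K: group "G\<lparr>carrier := K\<rparr>" using assms by (simp add: subgroup_imp_group)
  have "subgroup H (G\<lparr>carrier := K\<rparr>)" using assms by (simp add: subgroup_incl)
  from K.lagrange[OF this] have "card K = card (rcosets\<^bsub>G\<lparr>carrier := K\<rparr>\<^esub> H) * card H"
    by (simp add: order_def)
  then show ?thesis by (rule dvdI[OF trans[OF _ mult.commute]])
qed

section \<open>Centralizers as a Galois connection\<close>

lemma centralizer_subset: "centralizer G U \<subseteq> carrier G"
  by (auto simp: centralizer_def)

lemma subgroup_centralizer:
  assumes "U \<subseteq> carrier G" shows "subgroup (centralizer G U) G"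
proof (rule subgroupI)
  show "centralizer G U \<subseteq> carrier G" by (rule centralizer_subset)
  have "\<one> \<in> centralizer G U" using assms by (auto simp: centralizer_def)
  then show "centralizer G U \<noteq> {}" by blast
  fix a assume a: "a \<in> centralizer G U"
  show "inv a \<in> centralizer G U"
  proof -
    have "inv a \<otimes> u = u \<otimes> inv a" if "u \<in> U" for u
    proof -
      have c: "u \<in> carrier G" "a \<in> carrier G" "a \<otimes> u = u \<otimes> a"
        using a that assms by (auto simp: centralizer_def)
      then have "inv a \<otimes> (a \<otimes> u) \<otimes> inv a = inv a \<otimes> (u \<otimes> a) \<otimes> inv a" by simp
      then show ?thesis using c(1,2) by (simp add: free_simps)
    qed
    then show ?thesis using a by (auto simp: centralizer_def)
  qed
  fix b assume b: "b \<in> centralizer G U"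
  have "a \<otimes> b \<otimes> u = u \<otimes> (a \<otimes> b)" if u: "u \<in> U" for u
  proof -
    have "u \<in> carrier G" "a \<in> carrier G" "b \<in> carrier G" "a \<otimes> u = u \<otimes> a" "b \<otimes> u = u \<otimes> b"
      using a b u assms by (auto simp: centralizer_def)
    then show ?thesis by (metis m_assoc)
  qed
  then show "a \<otimes> b \<in> centralizer G U" using a b by (auto simp: centralizer_def)
qed

lemma centralizer_galois:
  assumes "U \<subseteq> carrier G" "V \<subseteq> carrier G"
  shows "U \<subseteq> centralizer G V \<longleftrightarrow> V \<subseteq> centralizer G U"
  using assms unfolding centralizer_def subset_iff mem_Collect_eq by (metis (no_types, lifting))

text \<open>The double centralizer of \<open>S\<close> is a subgroup containing \<open>S\<close>,
  hence contains what \<open>S\<close> generates; the Galois connection turns this around.\<close>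

lemma centralizer_generate:
  assumes "S \<subseteq> carrier G"
  shows "centralizer G (generate G S) = centralizer G S"
proof
  show "centralizer G (generate G S) \<subseteq> centralizer G S"
    by (auto simp: centralizer_def intro: generate.incl)
  have "S \<subseteq> centralizer G (centralizer G S)"
    using centralizer_galois[OF assms centralizer_subset] by blast
  then have "generate G S \<subseteq> centralizer G (centralizer G S)"
    by (intro generate_subgroup_incl subgroup_centralizer centralizer_subset)
  then show "centralizer G S \<subseteq> centralizer G (generate G S)"
    using centralizer_galois[OF centralizer_subset generate_incl[OF assms]] by blast
qed

lemma generate_abelian:
  assumes "S \<subseteq> carrier G" "S \<subseteq> centralizer G S"
  shows "generate G S \<subseteq> centralizer G (generate G S)"
  unfolding centralizer_generate[OF assms(1)]
  using assms by (intro generate_subgroup_incl subgroup_centralizer)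

lemma center_eq_centralizer: "center G = centralizer G (carrier G)"
  by (simp add: center_def centralizer_def)

lemma subgroup_center: "subgroup (center G) G"
  by (simp add: center_eq_centralizer subgroup_centralizer)

lemma center_le_centralizer: "U \<subseteq> carrier G \<Longrightarrow> center G \<subseteq> centralizer G U"
  by (auto simp: center_def centralizer_def)

lemma subgroup_of_center_normal:
  assumes "subgroup N G" "N \<subseteq> center G" shows "N \<lhd> G"
proof -
  have "x \<otimes> h \<otimes> inv x \<in> N" if "x \<in> carrier G" "h \<in> N" for x h
  proof -
    have h: "h \<in> carrier G" "h \<otimes> x = x \<otimes> h" using assms that by (auto simp: center_def)
    then have "x \<otimes> h \<otimes> inv x = h" using that by (metis inv_closed inv_solve_right m_closed)
    then show ?thesis using that by simp
  qed
  then show ?thesis using assms by (simp add: normal_inv_iff)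
qed

lemma center_normal: "center G \<lhd> G"
  by (simp add: subgroup_of_center_normal subgroup_center)

lemma centralizer_eq_carrier_iff:
  assumes "U \<subseteq> carrier G"
  shows "centralizer G U = carrier G \<longleftrightarrow> U \<subseteq> center G"
proof -
  have "centralizer G U = carrier G \<longleftrightarrow> carrier G \<subseteq> centralizer G U"
    using centralizer_subset by blast
  then show ?thesis
    using centralizer_galois[OF assms order_refl] by (simp add: center_eq_centralizer)
qed

section \<open>Cosets, and commutators modulo a normal subgroup\<close>

lemma rcos_eq_iff:
  assumes "N \<lhd> G" "u \<in> carrier G" "v \<in> carrier G"
  shows "N #> u = N #> v \<longleftrightarrow> u \<otimes> inv v \<in> N"
proof -
  interpret N: normal N G by fact
  have "u \<in> N #> v \<longleftrightarrow> u \<otimes> inv v \<in> N"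
    using assms N.rcos_module by (simp add: N.subgroup_axioms group_axioms)
  moreover have "N #> u = N #> v \<longleftrightarrow> u \<in> N #> v"
    using assms by (metis N.subgroup_axioms rcos_self repr_independence)
  ultimately show ?thesis by simp
qed

lemma commutator_mem_iff:
  assumes "N \<lhd> G" "x \<in> carrier G" "y \<in> carrier G"
  shows "commutator x y \<in> N \<longleftrightarrow> (N #> x) <#> (N #> y) = (N #> y) <#> (N #> x)"
proof -
  interpret N: normal N G by fact
  have "commutator x y = (x \<otimes> y) \<otimes> inv (y \<otimes> x)" using assms by (simp add: free_simps)
  then show ?thesis using assms rcos_eq_iff[OF assms(1), of "x \<otimes> y" "y \<otimes> x"] by (simp add: N.rcos_sum)
qed

lemma commutator_mem_sym:
  assumes "N \<lhd> G" "x \<in> carrier G" "y \<in> carrier G"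
  shows "commutator x y \<in> N \<longleftrightarrow> commutator y x \<in> N"
  using commutator_mem_iff assms by auto

text \<open>For normal \<open>N\<close> this is the full preimage in \<open>G\<close> of the
  centralizer of the image of \<open>U\<close> in \<open>G Mod N\<close>. The commutator form keeps
  most arguments about the quotient inside \<open>G\<close>.\<close>

definition centralizer_mod where
  "centralizer_mod N U = {g \<in> carrier G. \<forall>u\<in>U. commutator g u \<in> N}"

lemma subgroup_centralizer_mod:
  assumes N: "N \<lhd> G" and U: "U \<subseteq> carrier G"
  shows "subgroup (centralizer_mod N U) G"
proof -
  interpret N: normal N G by fact
  interpret Q: group "G Mod N" by (rule N.factorgroup_is_group)
  interpret h: group_hom G "G Mod N" "\<lambda>x. N #> x"
    using N.r_coset_hom_Mod by unfold_locales
  have im: "(\<lambda>x. N #> x) ` U \<subseteq> carrier (G Mod N)"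
    using U h.hom_closed by (auto simp: image_subset_iff)
  have "g \<in> centralizer_mod N U \<longleftrightarrow>
      g \<in> {g \<in> carrier G. N #> g \<in> centralizer (G Mod N) ((\<lambda>x. N #> x) ` U)}" for g
  proof (cases "g \<in> carrier G")
    case True
    then have "\<forall>u\<in>U. commutator g u \<in> N \<longleftrightarrow> (N #> g) <#> (N #> u) = (N #> u) <#> (N #> g)"
      using U commutator_mem_iff[OF N] by blast
    then show ?thesis
      unfolding centralizer_mod_def centralizer_def using True h.hom_closed[OF True]
      by (simp only: mult_FactGroup mem_Collect_eq ball_simps simp_thms cong: ball_cong)
  qed (simp add: centralizer_mod_def)
  then have "centralizer_mod N U = {g \<in> carrier G. N #> g \<in> centralizer (G Mod N) ((\<lambda>x. N #> x) ` U)}"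
    by blast
  also have "subgroup \<dots> G"
    by (rule h.subgroup_preimage[OF Q.subgroup_centralizer[OF im]])
  finally show ?thesis .
qed

lemma derived_subset_iff:
  assumes "subgroup N G"
  shows "derived G (carrier G) \<subseteq> N \<longleftrightarrow> (\<forall>x\<in>carrier G. \<forall>y\<in>carrier G. commutator x y \<in> N)"
proof -
  have "derived_set G (carrier G) \<subseteq> derived G (carrier G)"
    unfolding derived_def by (blast intro: generate.incl)
  then have "derived G (carrier G) \<subseteq> N \<longleftrightarrow> derived_set G (carrier G) \<subseteq> N"
    unfolding derived_def using generate_subgroup_incl[OF _ assms] unfolding derived_def by blast
  then show ?thesis by auto
qed

text \<open>The same criterion with the inverse on the left, the shape that
  \<open>card_image_times_subgroup\<close> asks for. The two quotients are conjugate by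
  \<open>u\<close>, so normality makes them equivalent.\<close>

lemma rcos_eq_iff':
  assumes N: "N \<lhd> G" and uv: "u \<in> carrier G" "v \<in> carrier G"
  shows "N #> u = N #> v \<longleftrightarrow> inv u \<otimes> v \<in> N"
proof -
  interpret N: normal N G by fact
  have "inv u \<otimes> v \<in> N \<longleftrightarrow> v \<otimes> inv u \<in> N"
  proof
    assume "inv u \<otimes> v \<in> N"
    then have "u \<otimes> (inv u \<otimes> v) \<otimes> inv u \<in> N" using N.inv_op_closed2 uv by blast
    then show "v \<otimes> inv u \<in> N" using uv by (simp add: inv_r_cancel)
  next
    assume "v \<otimes> inv u \<in> N"
    then have "inv u \<otimes> (v \<otimes> inv u) \<otimes> u \<in> N" using N.inv_op_closed1 uv by blast
    then show "inv u \<otimes> v \<in> N" using uv by (simp add: free_simps)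
  qed
  then show ?thesis using rcos_eq_iff[OF N uv(2,1)] by metis
qed

lemma card_cosets_in:
  assumes "N \<lhd> G" "subgroup A G" "N \<subseteq> A" "finite A"
  shows "card ((\<lambda>x. N #> x) ` A) * card N = card A"
proof (rule card_image_times_subgroup[OF assms(4,2) normal_imp_subgroup[OF assms(1)] assms(3)])
  fix g h assume "g \<in> A" "h \<in> A"
  then show "(N #> g = N #> h) = (inv g \<otimes> h \<in> N)"
    using rcos_eq_iff'[OF assms(1)] subgroup.mem_carrier[OF assms(2)] by blast
qed

lemma card_class_times_centralizer:
  assumes "finite (carrier G)" "x \<in> carrier G"
  shows "card ((\<lambda>g. g \<otimes> x \<otimes> inv g) ` carrier G) * card (centralizer G {x}) = order G"
  unfolding order_def
proof (rule card_image_times_subgroup[OF assms(1) subgroup_self])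
  show "subgroup (centralizer G {x}) G" using assms(2) by (simp add: subgroup_centralizer)
  fix g h assume "g \<in> carrier G" "h \<in> carrier G"
  then show "(g \<otimes> x \<otimes> inv g = h \<otimes> x \<otimes> inv h) = (inv g \<otimes> h \<in> centralizer G {x})"
    using conj_eq_iff[of g h x] assms(2) by (simp add: centralizer_def)
qed (rule centralizer_subset)

lemma card_commutators_times_centralizer:
  assumes "finite (carrier G)" "subgroup K G" "x \<in> carrier G"
  shows "card ((\<lambda>g. commutator g x) ` K) * card (K \<inter> centralizer G {x}) = card K"
proof (rule card_image_times_subgroup)
  show "finite K" using assms finite_subset subgroup.subset by blast
  show "subgroup K G" by fact
  show "subgroup (K \<inter> centralizer G {x}) G"
    using assms by (simp add: subgroup_centralizer subgroups_Inter_pair)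
  fix g h assume gh: "g \<in> K" "h \<in> K"
  then have c: "g \<in> carrier G" "h \<in> carrier G" using subgroup.mem_carrier[OF assms(2)] by auto
  have "inv g \<otimes> h \<in> K" using gh assms(2) by (simp add: subgroup.m_closed subgroup.m_inv_closed)
  then show "(commutator g x = commutator h x) = (inv g \<otimes> h \<in> K \<inter> centralizer G {x})"
    using commutator_eq_iff[OF c assms(3)] c by (simp add: centralizer_def)
qed simp

lemma centralizer_mod_singleton:
  assumes "N \<lhd> G" "x \<in> carrier G"
  shows "centralizer_mod N {x} = {g \<in> carrier G. N #> g \<in> centralizer (G Mod N) {N #> x}}"
proof -
  interpret N: normal N G by fact
  have "N #> g \<in> carrier (G Mod N)" if "g \<in> carrier G" for g
    using that by (auto simp: carrier_FactGroup)
  then show ?thesis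
    using commutator_mem_iff[OF assms(1) _ assms(2)]
    by (auto simp: centralizer_mod_def centralizer_def)
qed

text \<open>The conjugates of a coset $aN \neq N$ inside $A/N$ miss the trivial coset.\<close>

lemma centralizer_mod_large:
  assumes fin: "finite (carrier G)" and N: "N \<lhd> G" and A: "A \<lhd> G" "N \<subseteq> A" and a: "a \<in> A - N"
  shows "order G * card N < card (centralizer_mod N {a}) * card A"
proof -
  interpret N: normal N G by fact
  interpret A: normal A G by fact
  interpret Q: group "G Mod N" by (rule N.factorgroup_is_group)
  interpret h: group_hom G "G Mod N" "\<lambda>x. N #> x"
    using N.r_coset_hom_Mod by unfold_locales
  define f where "f g = N #> (g \<otimes> a \<otimes> inv g)" for g
  have ac: "a \<in> carrier G" using a by auto
  have finA: "finite A" using fin A.subset finite_subset by blast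
  have sub: "subgroup (centralizer_mod N {a}) G" using subgroup_centralizer_mod[OF N] ac by simp
  have "card (f ` carrier G) * card (centralizer_mod N {a}) = card (carrier G)"
  proof (rule card_image_times_subgroup[OF fin subgroup_self sub subgroup.subset[OF sub]])
    fix g h assume gh: "g \<in> carrier G" "h \<in> carrier G"
    have f: "f u = (N #> u) \<otimes>\<^bsub>G Mod N\<^esub> (N #> a) \<otimes>\<^bsub>G Mod N\<^esub> inv\<^bsub>G Mod N\<^esub> (N #> u)"
      if "u \<in> carrier G" for u
      using that ac by (simp add: f_def h.hom_mult h.hom_inv del: mult_FactGroup)
    have "f g = f h \<longleftrightarrow> (N #> (inv g \<otimes> h)) \<otimes>\<^bsub>G Mod N\<^esub> (N #> a) = (N #> a) \<otimes>\<^bsub>G Mod N\<^esub> (N #> (inv g \<otimes> h))"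
      using gh ac Q.conj_eq_iff[of "N #> g" "N #> h" "N #> a"] h.hom_closed
      by (simp add: f h.hom_mult h.hom_inv del: mult_FactGroup)
    then show "f g = f h \<longleftrightarrow> inv g \<otimes> h \<in> centralizer_mod N {a}"
      unfolding centralizer_mod_singleton[OF N ac] using gh
      by (simp add: centralizer_def del: mult_FactGroup)
  qed
  then have eq: "card (f ` carrier G) * card (centralizer_mod N {a}) = order G" by (simp add: order_def)
  have "f ` carrier G \<subseteq> (\<lambda>x. N #> x) ` A - {N}"
  proof -
    have "f g \<noteq> N" if g: "g \<in> carrier G" for g
    proof
      assume "f g = N"
      then have "g \<otimes> a \<otimes> inv g \<in> N"
        using g ac rcos_self[OF _ N.subgroup_axioms, of "g \<otimes> a \<otimes> inv g"] by (simp add: f_def)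
      then have "inv g \<otimes> (g \<otimes> a \<otimes> inv g) \<otimes> g \<in> N" using N.inv_op_closed1 g by blast
      then have "a \<in> N" using g ac by (simp add: free_simps)
      then show False using a by blast
    qed
    moreover have "g \<otimes> a \<otimes> inv g \<in> A" if "g \<in> carrier G" for g
      using that a A.inv_op_closed2 by blast
    ultimately show ?thesis by (auto simp: f_def)
  qed
  also have "\<dots> \<subset> (\<lambda>x. N #> x) ` A"
  proof -
    have "N = N #> \<one>" by (simp add: N.subset)
    then have "N \<in> (\<lambda>x. N #> x) ` A" by (metis A.one_closed imageI)
    then show ?thesis by blast
  qed
  finally have "card (f ` carrier G) < card ((\<lambda>x. N #> x) ` A)"
    using finA by (intro psubset_card_mono) auto
  moreover have "0 < card N" using fin N.finite_imp_card_positive by blast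
  moreover have "0 < card (centralizer_mod N {a})"
    using fin sub subgroup.finite_imp_card_positive by blast
  ultimately have "card (centralizer_mod N {a}) * (card (f ` carrier G) * card N)
      < card (centralizer_mod N {a}) * (card ((\<lambda>x. N #> x) ` A) * card N)"
    by simp
  then show ?thesis
    using eq card_cosets_in[OF N A.subgroup_axioms A(2) finA] by (metis mult.assoc mult.commute)
qed

section \<open>Commutators lying in the centre\<close>

lemma commutator_mult_left:
  assumes "a \<in> carrier G" "b \<in> carrier G" "x \<in> carrier G" "commutator b x \<in> center G"
  shows "commutator (a \<otimes> b) x = commutator a x \<otimes> commutator b x"
proof -
  have "commutator (a \<otimes> b) x = a \<otimes> commutator b x \<otimes> (x \<otimes> inv a \<otimes> inv x)"
    using assms(1-3) by (simp add: free_simps)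
  also have "\<dots> = commutator b x \<otimes> a \<otimes> (x \<otimes> inv a \<otimes> inv x)"
    using assms by (simp add: center_def)
  also have "\<dots> = commutator b x \<otimes> commutator a x"
    using assms(1-3) by (simp add: m_assoc)
  also have "\<dots> = commutator a x \<otimes> commutator b x"
    using assms by (simp add: center_def)
  finally show ?thesis .
qed

lemma commutators_with_subgroup:
  assumes K: "subgroup K G" and x: "x \<in> carrier G"
    and central: "\<And>g. g \<in> K \<Longrightarrow> commutator g x \<in> center G"
  shows "subgroup ((\<lambda>g. commutator g x) ` K) G"
proof -
  have Kc: "g \<in> carrier G" if "g \<in> K" for g using K that by (rule subgroup.mem_carrier)
  have 1: "commutator \<one> x = \<one>" using x by simp
  show ?thesis
  proof (rule subgroupI)
    show "(\<lambda>g. commutator g x) ` K \<subseteq> carrier G" using Kc x by auto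
    show "(\<lambda>g. commutator g x) ` K \<noteq> {}" using subgroup.one_closed[OF K] by blast
    fix u assume "u \<in> (\<lambda>g. commutator g x) ` K"
    then obtain g where g: "g \<in> K" "u = commutator g x" by blast
    have gi: "inv g \<in> K" using g K by (simp add: subgroup.m_inv_closed)
    \<comment> \<open>Multiplicativity applied to \<open>inv g\<close> times \<open>g\<close>; it
      identifies the inverse of a commutator as another commutator with \<open>x\<close>.\<close>
    have "\<one> = commutator (inv g) x \<otimes> commutator g x"
      using commutator_mult_left[OF _ _ x central[OF g(1)], of "inv g"] g(1) Kc 1 by simp
    then have "inv u = commutator (inv g) x"
      using g Kc x by (intro inv_equality) auto
    then show "inv u \<in> (\<lambda>g. commutator g x) ` K" using gi by blast
    fix v assume "v \<in> (\<lambda>g. commutator g x) ` K"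
    then obtain h where h: "h \<in> K" "v = commutator h x" by blast
    have "u \<otimes> v = commutator (g \<otimes> h) x"
      using commutator_mult_left[OF _ _ x central[OF h(1)], of g] g h Kc by simp
    then show "u \<otimes> v \<in> (\<lambda>g. commutator g x) ` K"
      using subgroup.m_closed[OF K g(1) h(1)] by blast
  qed
qed

lemma commutator_elt_eq:
  "commutator_elt G A x = generate G ((\<lambda>a. commutator a x) ` A)"
  by (simp add: commutator_elt_def image_def Setcompr_eq_image)

text \<open>The product set is a disjoint union of cosets of \<open>A\<close>, one for each coset of
  the intersection in \<open>U\<close>.\<close>

lemma card_set_mult_times_Int:
  assumes fin: "finite (carrier G)" and U: "subgroup U G" and A: "A \<lhd> G"
  shows "card (U <#> A) * card (U \<inter> A) = card U * card A"
proof -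
  interpret A: normal A G by fact
  have Uc: "U \<subseteq> carrier G" using U by (rule subgroup.subset)
  have eq: "card ((\<lambda>u. A #> u) ` U) * card (U \<inter> A) = card U"
  proof (rule card_image_times_subgroup)
    show "finite U" using Uc fin finite_subset by blast
    show "subgroup (U \<inter> A) G" using U A.subgroup_axioms by (rule subgroups_Inter_pair)
    fix g h assume gh: "g \<in> U" "h \<in> U"
    then have "inv g \<otimes> h \<in> U" using U by (simp add: subgroup.m_closed subgroup.m_inv_closed)
    then show "(A #> g = A #> h) = (inv g \<otimes> h \<in> U \<inter> A)"
      using rcos_eq_iff'[OF A, of g h] gh Uc by auto
  qed (use U in auto)
  have "A #> u = u <# A" if "u \<in> U" for u using A.coset_eq that Uc by blast
  then have "U <#> A = \<Union> ((\<lambda>u. A #> u) ` U)"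
    by (auto simp: set_mult_def l_coset_def)
  also have "card \<dots> = card A * card ((\<lambda>u. A #> u) ` U)"
  proof (rule card_partition[symmetric])
    have sub: "(\<lambda>u. A #> u) ` U \<subseteq> rcosets A" using Uc by (auto simp: RCOSETS_def)
    show "finite ((\<lambda>u. A #> u) ` U)" using Uc fin finite_subset by blast
    show "finite (\<Union> ((\<lambda>u. A #> u) ` U))"
      using Uc A.subset fin r_coset_subset_G by (meson UN_least finite_subset subsetD)
    show "card c = card A" if "c \<in> (\<lambda>u. A #> u) ` U" for c
    proof -
      have "c \<in> rcosets A" using that sub by blast
      then obtain f where "bij_betw f A c" using card_cosets_equal A.subset by blast
      then show ?thesis using bij_betw_same_card by metis
    qed
    show "c1 \<inter> c2 = {}" if "c1 \<in> (\<lambda>u. A #> u) ` U" "c2 \<in> (\<lambda>u. A #> u) ` U" "c1 \<noteq> c2" for c1 c2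
      using that sub rcos_disjoint[OF A.subgroup_axioms] unfolding pairwise_def disjnt_def by (meson subsetD)
  qed
  finally show ?thesis using eq by (metis mult.assoc mult.commute)
qed

lemma inv_commutator:
  "\<lbrakk>x \<in> carrier G; y \<in> carrier G\<rbrakk> \<Longrightarrow> inv (commutator x y) = commutator y x"
  by (simp add: free_simps)

lemma generate_subgroup: "subgroup H G \<Longrightarrow> generate G H = H"
  using generate_subgroup_incl[of H H] by (auto intro: generate.incl)

text \<open>Test subgroups for the measure: including the centre leaves the centralizer unchanged,
  keeps commuting sets abelian, and makes the order at least p|Z| as soon as \<open>S\<close> is not
  central.\<close>

definition adjoin where
  "adjoin S = generate G (S \<union> center G)"

lemma center_subset: "center G \<subseteq> carrier G"
  by (simp add: subgroup.subset subgroup_center)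

lemma subgroup_adjoin: "S \<subseteq> carrier G \<Longrightarrow> subgroup (adjoin S) G"
  unfolding adjoin_def using center_subset by (intro generate_is_subgroup) auto

lemma subset_adjoin: "S \<subseteq> adjoin S" "center G \<subseteq> adjoin S"
  by (auto simp: adjoin_def intro: generate.incl)

lemma adjoin_mono: "S \<subseteq> T \<Longrightarrow> adjoin S \<subseteq> adjoin T"
  unfolding adjoin_def by (intro mono_generate) auto

lemma centralizer_adjoin:
  assumes "S \<subseteq> carrier G" shows "centralizer G (adjoin S) = centralizer G S"
proof -
  have "centralizer G (adjoin S) = centralizer G (S \<union> center G)"
    unfolding adjoin_def using assms center_subset by (intro centralizer_generate) auto
  also have "\<dots> = centralizer G S" by (auto simp: centralizer_def center_def)
  finally show ?thesis .
qed

lemma adjoin_abelian: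
  assumes "S \<subseteq> carrier G" "S \<subseteq> centralizer G S"
  shows "adjoin S \<subseteq> centralizer G (adjoin S)"
proof -
  have "S \<union> center G \<subseteq> centralizer G (S \<union> center G)"
    using assms by (auto simp: centralizer_def center_def)
  then show ?thesis
    unfolding adjoin_def using assms(1) center_subset by (intro generate_abelian) auto
qed

end

section \<open>Finite $p$-groups\<close>

text \<open>The exponent is a parameter because the locale is also instantiated for a quotient and
  for the largest member of the lattice, whose orders are other powers of p.\<close>

locale finite_p_group = group +
  fixes p k :: nat
  assumes prime: "Factorial_Ring.prime p" and order_eq: "order G = p ^ k"
begin

lemma p_gt_1: "1 < p"
  using prime by (rule prime_gt_1_nat)

lemma power_cancel:
  "p ^ n * a = p ^ n * b \<longleftrightarrow> a = b"
  "p ^ n * a \<le> p ^ n * b \<longleftrightarrow> a \<le> b"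
  "a * p ^ n \<le> b * p ^ n \<longleftrightarrow> a \<le> b"
  using p_gt_1 by simp_all

lemma finite_carrier: "finite (carrier G)"
  using order_eq p_gt_1 by (metis order_gt_0_iff_finite zero_less_power zero_less_one less_trans)

lemma finite_subgroup: "subgroup H G \<Longrightarrow> finite H"
  using finite_carrier finite_subset subgroup.subset by blast

lemma subgroup_card_pos: "subgroup H G \<Longrightarrow> 0 < card H"
  using finite_carrier subgroup.finite_imp_card_positive by blast

lemma subgroup_card_power:
  assumes "subgroup H G" obtains j where "j \<le> k" "card H = p ^ j"
proof -
  have "card H dvd p ^ k"
    using card_dvd_subgroup[OF finite_carrier subgroup_self assms subgroup.subset[OF assms]]
    by (simp add: order_eq[symmetric] order_def)
  then show ?thesis using divides_primepow_nat[OF prime] that by blast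
qed

text \<open>Both orders are powers of p, so a strict inequality costs a whole factor p.\<close>

lemma psubgroup_card:
  assumes "subgroup H G" "subgroup K G" "H \<subset> K"
  shows "p * card H \<le> card K"
proof -
  obtain i j where ij: "card H = p ^ i" "card K = p ^ j"
    using subgroup_card_power assms by metis
  have "card H < card K" using assms finite_subgroup by (simp add: psubset_card_mono)
  then have "Suc i \<le> j" using ij p_gt_1 by simp
  then have "p ^ Suc i \<le> p ^ j" using p_gt_1 by (intro power_increasing) auto
  then show ?thesis using ij by simp
qed

text \<open>The class equation restricted to \<open>N\<close>: the noncentral part of
  \<open>N\<close> is a union of classes of size divisible by p, and p divides |N|. So p divides the
  order of the intersection with the centre, which contains the identity and therefore something
  else.\<close>

lemma normal_meets_center:
  assumes N: "N \<lhd> G" "N \<noteq> {\<one>}"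
  obtains b where "b \<in> N" "b \<in> center G" "b \<noteq> \<one>"
proof -
  interpret N: normal N G by fact
  define cls where "cls x = (\<lambda>g. g \<otimes> x \<otimes> inv g) ` carrier G" for x
  have finN: "finite N" by (simp add: finite_subgroup N.subgroup_axioms)
  have self: "x \<in> cls x" if "x \<in> carrier G" for x
    unfolding cls_def using that by (intro image_eqI[of _ _ \<one>]) auto
  have cls_dvd: "p dvd card (cls x)" if x: "x \<in> carrier G" "x \<notin> center G" for x
  proof -
    have eq: "card (cls x) * card (centralizer G {x}) = p ^ k"
      using card_class_times_centralizer[OF finite_carrier x(1)] by (simp add: cls_def order_eq)
    have "card (cls x) \<noteq> 1"
    proof
      assume "card (cls x) = 1"
      then have "cls x = {x}" using self[OF x(1)] by (metis card_1_singletonE singletonD)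
      then have "g \<otimes> x \<otimes> inv g = x" if "g \<in> carrier G" for g using that by (auto simp: cls_def)
      then have "x \<otimes> g = g \<otimes> x" if "g \<in> carrier G" for g
        using that x by (metis inv_closed inv_solve_right m_closed)
      then show False using x by (auto simp: center_def)
    qed
    moreover have "card (cls x) dvd p ^ k" using eq by (metis dvd_triv_left)
    ultimately show ?thesis
      using divides_primepow_nat[OF prime] by (metis dvd_power gr0I power_0)
  qed
  have disj: "cls x = cls y" if xy: "x \<in> carrier G" "y \<in> carrier G" "cls x \<inter> cls y \<noteq> {}" for x y
  proof -
    have sub: "cls u \<subseteq> cls v" if uv: "u \<in> carrier G" "v \<in> carrier G" "cls u \<inter> cls v \<noteq> {}" for u v
    proof
      fix w assume "w \<in> cls u"
      then obtain g where g: "g \<in> carrier G" "w = g \<otimes> u \<otimes> inv g" by (auto simp: cls_def)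
      obtain h l where hl: "h \<in> carrier G" "l \<in> carrier G" "h \<otimes> u \<otimes> inv h = l \<otimes> v \<otimes> inv l"
        using uv by (auto simp: cls_def)
      \<comment> \<open>A common conjugate of \<open>u\<close> and \<open>v\<close> is solved for
        \<open>u\<close>; conjugating by \<open>g\<close> then gives a conjugate of \<open>v\<close>
        by \<open>g \<otimes> inv h \<otimes> l\<close>.\<close>
      have "u = inv h \<otimes> (h \<otimes> u \<otimes> inv h) \<otimes> h" using hl(1,2) uv by (simp add: free_simps)
      then have "u = inv h \<otimes> (l \<otimes> v \<otimes> inv l) \<otimes> h" by (simp only: hl(3))
      then have "w = (g \<otimes> inv h \<otimes> l) \<otimes> v \<otimes> inv (g \<otimes> inv h \<otimes> l)"
        using g hl(1,2) uv by (simp add: free_simps)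
      then show "w \<in> cls v" unfolding cls_def using g hl(1,2) by (intro image_eqI[of _ _ "g \<otimes> inv h \<otimes> l"]) auto
    qed
    show ?thesis using sub[OF xy] sub[OF xy(2,1)] xy(3) by blast
  qed
  have conjN: "cls x \<subseteq> N - center G" if x: "x \<in> N - center G" for x
  proof
    fix w assume w: "w \<in> cls x"
    then obtain g where g: "g \<in> carrier G" "w = g \<otimes> x \<otimes> inv g" by (auto simp: cls_def)
    have xc: "x \<in> carrier G" using x by auto
    have "w \<notin> center G"
    proof
      assume wc: "w \<in> center G"
      have "inv g \<otimes> w \<otimes> g \<in> center G"
        using normal.inv_op_closed1[OF center_normal g(1) wc] .
      then show False using x g xc by (simp add: free_simps)
    qed
    moreover have "w \<in> N" using g x N.inv_op_closed2 by blast
    ultimately show "w \<in> N - center G" by blast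
  qed
  have "\<Union> (cls ` (N - center G)) = N - center G"
    using conjN self N.subset by blast
  moreover have "p dvd card (\<Union> (cls ` (N - center G)))"
  proof (rule dvd_partition)
    show "finite (\<Union> (cls ` (N - center G)))" using calculation finN by simp
    show "\<forall>c\<in>cls ` (N - center G). p dvd card c" using cls_dvd N.subset by auto
    show "\<forall>c1\<in>cls ` (N - center G). \<forall>c2\<in>cls ` (N - center G). c1 \<noteq> c2 \<longrightarrow> c1 \<inter> c2 = {}"
      using disj N.subset by blast
  qed
  ultimately have "p dvd card (N - center G)" by simp
  moreover have "p dvd card N"
  proof -
    obtain j where j: "card N = p ^ j" using subgroup_card_power[OF N.subgroup_axioms] by metis
    have "j \<noteq> 0"
    proof
      assume "j = 0"
      then have "card N = 1" using j by simp
      then show False using N(2) N.one_closed by (metis card_1_singletonE singletonD)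
    qed
    then show ?thesis using j by simp
  qed
  moreover have "card N = card (N - center G) + card (N \<inter> center G)"
    using finN by (metis add.commute card_Int_Diff)
  ultimately have "p dvd card (N \<inter> center G)" by (metis dvd_add_right_iff)
  moreover have "\<one> \<in> N \<inter> center G"
    using N.one_closed subgroup.one_closed[OF subgroup_center] by blast
  ultimately have "N \<inter> center G \<noteq> {\<one>}" using p_gt_1 by auto
  then show ?thesis using that \<open>\<one> \<in> N \<inter> center G\<close> by blast
qed

text \<open>This is \<open>normal_meets_center\<close> for A/N in G/N, pulled back to
  \<open>G\<close>.\<close>

lemma exists_central_mod:
  assumes N: "N \<lhd> G" and A: "A \<lhd> G" "N \<subset> A"
  obtains b where "b \<in> A - N" "\<And>g. g \<in> carrier G \<Longrightarrow> commutator b g \<in> N"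
proof -
  interpret N: normal N G by fact
  interpret A: normal A G by fact
  interpret Q: group "G Mod N" by (rule N.factorgroup_is_group)
  interpret h: group_hom G "G Mod N" "\<lambda>x. N #> x"
    using N.r_coset_hom_Mod by unfold_locales
  have "order (G Mod N) * card N = p ^ k"
    using card_cosets_in[OF N subgroup_self N.subset finite_carrier]
    by (simp add: order_def carrier_FactGroup order_eq[symmetric])
  then obtain j where "order (G Mod N) = p ^ j"
    using divides_primepow_nat[OF prime] by (metis dvd_triv_left)
  then interpret Q: finite_p_group "G Mod N" p j
    using prime by unfold_locales
  have AQ: "(\<lambda>x. N #> x) ` A \<lhd> G Mod N"
    using A.surj_hom_normal_subgroup[OF h.group_hom_axioms] by (simp add: carrier_FactGroup)
  obtain a where a: "a \<in> A" "a \<notin> N" using A(2) by blast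
  have "N #> a \<noteq> N" using a rcos_self[OF _ N.subgroup_axioms, of a] by auto
  then have "(\<lambda>x. N #> x) ` A \<noteq> {\<one>\<^bsub>G Mod N\<^esub>}" using a(1) by auto
  then obtain c where c: "c \<in> (\<lambda>x. N #> x) ` A" "c \<in> center (G Mod N)" "c \<noteq> N"
    using Q.normal_meets_center[OF AQ] by (metis one_FactGroup)
  then obtain b where b: "b \<in> A" "c = N #> b" by blast
  have "b \<notin> N" using b c(3) by (metis N.rcos_const group_axioms)
  moreover have "commutator b g \<in> N" if g: "g \<in> carrier G" for g
  proof -
    have "N #> g \<in> carrier (G Mod N)" using g by (auto simp: carrier_FactGroup)
    then have "(N #> b) <#> (N #> g) = (N #> g) <#> (N #> b)"
      using c(2) b(2) by (auto simp: center_def)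
    then show ?thesis using commutator_mem_iff[OF N _ g] b(1) by simp
  qed
  ultimately show ?thesis using that b(1) by blast
qed

text \<open>A group whose centre has index at most $p$ is abelian, applied to $G/N$.\<close>

lemma derived_subset_if_centralizer_mod_large:
  assumes N: "N \<lhd> G" and large: "order G \<le> p * card (centralizer_mod N (carrier G))"
  shows "derived G (carrier G) \<subseteq> N"
proof -
  let ?Y = "centralizer_mod N (carrier G)"
  have Y: "subgroup ?Y G" by (simp add: N subgroup_centralizer_mod)
  have "g \<in> ?Y" if g: "g \<in> carrier G" for g
  proof (rule ccontr)
    assume gY: "g \<notin> ?Y"
    have K: "subgroup (centralizer_mod N {g}) G" by (simp add: N subgroup_centralizer_mod g)
    \<comment> \<open>Both \<open>?Y\<close> and \<open>g\<close> centralize \<open>g\<close> modulo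
      \<open>N\<close>. So this subgroup properly contains \<open>?Y\<close>, and the index bound
      makes it everything.\<close>
    have "?Y \<subseteq> centralizer_mod N {g}" using g by (auto simp: centralizer_mod_def)
    moreover have "g \<in> centralizer_mod N {g}"
      using g subgroup.one_closed[OF normal_imp_subgroup[OF N]] by (simp add: centralizer_mod_def m_assoc)
    ultimately have "p * card ?Y \<le> card (centralizer_mod N {g})"
      using psubgroup_card[OF Y K] gY by blast
    then have "centralizer_mod N {g} = carrier G"
      using large card_seteq[OF finite_carrier subgroup.subset[OF K]] by (simp add: order_def)
    then have "\<forall>h\<in>carrier G. commutator h g \<in> N" by (auto simp: centralizer_mod_def)
    then have "g \<in> ?Y" using g commutator_mem_sym[OF N g] by (simp add: centralizer_mod_def)
    then show False using gY by blast
  qed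
  then show ?thesis
    unfolding derived_subset_iff[OF normal_imp_subgroup[OF N]] by (auto simp: centralizer_mod_def)
qed

end

section \<open>Groups with the commutator condition\<close>

locale central_commutator_group = finite_p_group +
  fixes A
  assumes k6: "k = 6" and card_center: "card (center G) = p ^ 2"
    and card_derived: "card (derived G (carrier G)) = p ^ 3"
    and A: "central_commutator_subgroup G p A"
begin

lemma A_normal: "A \<lhd> G" and card_A: "card A = p ^ 4"
  and commutators_A: "x \<in> carrier G - A \<Longrightarrow> commutator_elt G A x = center G"
  using A by (auto simp: central_commutator_subgroup_def)

sublocale A: normal A G by (rule A_normal)

lemma A_commute: "a \<in> A \<Longrightarrow> b \<in> A \<Longrightarrow> a \<otimes> b = b \<otimes> a"
  using A comm_groupE(4)[of "G\<lparr>carrier := A\<rparr>"] by (auto simp: central_commutator_subgroup_def)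

lemma A_psubset: "A \<subset> carrier G"
proof -
  have "card A \<noteq> card (carrier G)"
    using card_A order_eq k6 p_gt_1 by (simp add: order_def)
  then show ?thesis using A.subset by blast
qed

lemma commutator_central:
  assumes "a \<in> A" "x \<in> carrier G" shows "commutator a x \<in> center G"
proof (cases "x \<in> A")
  case True
  then have "commutator a x = \<one>"
    using assms A_commute[OF assms(1) True] commutator_eq_one_iff[of a x] by auto
  then show ?thesis using subgroup.one_closed[OF subgroup_center] by simp
next
  case False
  then show ?thesis
    using commutators_A[of x] assms by (auto simp: commutator_elt_eq intro: generate.incl)
qed

text \<open>The centre equals [A, x] for some \<open>x\<close> outside \<open>A\<close>, and
  normality keeps [A, x] inside \<open>A\<close>.\<close>

lemma center_le_A: "center G \<subseteq> A"
proof -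
  obtain x where x: "x \<in> carrier G - A" using A_psubset by blast
  have "commutator a x \<in> A" if a: "a \<in> A" for a
  proof -
    have "x \<otimes> inv a \<otimes> inv x \<in> A" using A.inv_op_closed2 a x by blast
    then have "a \<otimes> (x \<otimes> inv a \<otimes> inv x) \<in> A" using a by blast
    then show ?thesis using a x by (simp add: m_assoc)
  qed
  then have "generate G ((\<lambda>a. commutator a x) ` A) \<subseteq> A"
    by (intro generate_subgroup_incl A.subgroup_axioms) auto
  then show ?thesis using commutators_A[OF x] by (simp add: commutator_elt_eq)
qed

text \<open>The commutators with \<open>x\<close> already form a subgroup, so they fill the centre.
  Each fibre of the map from \<open>A\<close> then has p^4 / p^2 = p^2 elements; the kernel contains
  the centre, which has the same order.\<close>

lemma commuting_outside:
  assumes "x \<in> carrier G - A" "a \<in> A" "a \<otimes> x = x \<otimes> a"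
  shows "a \<in> center G"
proof -
  have xc: "x \<in> carrier G" using assms by blast
  have sub: "subgroup ((\<lambda>g. commutator g x) ` A) G"
    using commutator_central xc by (intro commutators_with_subgroup A.subgroup_axioms) auto
  then have "(\<lambda>g. commutator g x) ` A = center G"
    using commutators_A[OF assms(1)] generate_subgroup_incl[OF order_refl sub]
      generate.incl[of _ "(\<lambda>g. commutator g x) ` A" G]
    by (auto simp: commutator_elt_eq)
  then have "p ^ 2 * card (A \<inter> centralizer G {x}) = p ^ 4"
    using card_commutators_times_centralizer[OF finite_carrier A.subgroup_axioms xc]
      card_center card_A by simp
  also have "\<dots> = p ^ 2 * p ^ 2" by (simp flip: power_add)
  finally have "card (A \<inter> centralizer G {x}) = card (center G)"
    by (simp only: power_cancel card_center)
  moreover have "center G \<subseteq> A \<inter> centralizer G {x}"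
    using center_le_A center_le_centralizer xc by auto
  moreover have "finite (A \<inter> centralizer G {x})"
    using A.subset finite_carrier finite_subset by blast
  ultimately have "center G = A \<inter> centralizer G {x}" by (metis card_subset_eq)
  then show ?thesis using assms A.subset by (auto simp: centralizer_def)
qed

section \<open>Subgroups of maximal measure\<close>

lemma centralizer_le_A:
  assumes "a \<in> U" "a \<in> A" "a \<notin> center G" shows "centralizer G U \<subseteq> A"
proof
  fix x assume "x \<in> centralizer G U"
  then have "x \<in> carrier G" "a \<otimes> x = x \<otimes> a" using assms by (auto simp: centralizer_def)
  then show "x \<in> A" using commuting_outside assms by blast
qed

lemma centralizer_A: "centralizer G A = A"
proof
  have "\<not> A \<subseteq> center G"
  proof
    assume "A \<subseteq> center G"
    then have "card A \<le> card (center G)" by (simp add: card_mono finite_subgroup subgroup_center)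
    then show False using card_A card_center p_gt_1 by simp
  qed
  then show "centralizer G A \<subseteq> A" using centralizer_le_A by blast
  show "A \<subseteq> centralizer G A" using A_commute by (auto simp: centralizer_def)
qed

lemma derived_not_central: "\<not> derived G (carrier G) \<subseteq> center G"
proof
  assume "derived G (carrier G) \<subseteq> center G"
  then have "card (derived G (carrier G)) \<le> card (center G)"
    by (simp add: card_mono finite_subgroup subgroup_center)
  then show False using card_derived card_center p_gt_1 by simp
qed

lemma card_carrier: "card (carrier G) = p ^ 6"
  using order_eq k6 by (simp add: order_def)

text \<open>In |UA||U \<inter> A| = |U|p^4 the left factors are at most p^6 and p^2. If |U| = p^4,
  both bounds are attained.\<close>

lemma card_subgroup_off_A:
  assumes U: "subgroup U G" and UA: "U \<inter> A \<subseteq> center G"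
  shows "card U \<le> p ^ 4" and "card U = p ^ 4 \<Longrightarrow> U <#> A = carrier G"
proof -
  have eq: "card (U <#> A) * card (U \<inter> A) = card U * p ^ 4"
    using card_set_mult_times_Int[OF finite_carrier U A_normal] card_A by simp
  have UAc: "U <#> A \<subseteq> carrier G" using U A.subset by (simp add: setmult_subset_G subgroup.subset)
  have 1: "card (U <#> A) \<le> p ^ 6"
    using card_mono[OF finite_carrier UAc] card_carrier by simp
  have 2: "card (U \<inter> A) \<le> p ^ 2"
    using card_mono[OF finite_subgroup[OF subgroup_center] UA] card_center by simp
  have "card U * p ^ 4 \<le> p ^ 6 * p ^ 2" using mult_le_mono[OF 1 2] eq by simp
  also have "\<dots> = p ^ 4 * p ^ 4" by (simp flip: power_add)
  finally show "card U \<le> p ^ 4" by (simp only: power_cancel)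
  assume "card U = p ^ 4"
  then have "card (U <#> A) * card (U \<inter> A) = p ^ 6 * p ^ 2" using eq by (simp flip: power_add)
  then have "p ^ 6 * card (U \<inter> A) \<le> card (U <#> A) * card (U \<inter> A)"
    using mult_le_mono2[OF 2, of "p ^ 6"] by (simp only:)
  moreover have "0 < card (U \<inter> A)"
    using U A.subgroup_axioms by (simp add: subgroup_card_pos subgroups_Inter_pair)
  ultimately have "card (carrier G) \<le> card (U <#> A)" using card_carrier by simp
  then show "U <#> A = carrier G" using card_seteq[OF finite_carrier UAc] by simp
qed

text \<open>Commutators modulo the centre do not see the factors from $A$.\<close>

lemma derived_central_if_factors:
  assumes U: "subgroup U G" and V: "subgroup V G" "V \<subseteq> centralizer G U"
    and UA: "U <#> A = carrier G" and VA: "V <#> A = carrier G"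
  shows "derived G (carrier G) \<subseteq> center G"
proof -
  let ?Z = "center G"
  have Uc: "U \<subseteq> carrier G" and Vc: "V \<subseteq> carrier G"
    using U V(1) by (auto dest: subgroup.subset)
  have mod: "centralizer_mod ?Z {x} = carrier G"
    if x: "x \<in> carrier G" and W: "subgroup W G" "W <#> A = carrier G"
      "\<And>w. w \<in> W \<Longrightarrow> commutator w x \<in> ?Z" for x W
  proof -
    have sub: "subgroup (centralizer_mod ?Z {x}) G"
      by (simp add: subgroup_centralizer_mod center_normal x)
    have "A \<subseteq> centralizer_mod ?Z {x}" using commutator_central x by (auto simp: centralizer_mod_def)
    moreover have "W \<subseteq> centralizer_mod ?Z {x}"
      using W(3) subgroup.mem_carrier[OF W(1)] by (auto simp: centralizer_mod_def)
    ultimately have "W <#> A \<subseteq> centralizer_mod ?Z {x}"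
      using subgroup.m_closed[OF sub] by (auto simp: set_mult_def)
    then show ?thesis using W(2) subgroup.subset[OF sub] by blast
  qed
  have uv: "commutator u v \<in> ?Z" if "u \<in> U" "v \<in> V" for u v
  proof -
    have "u \<otimes> v = v \<otimes> u" using that V(2) by (auto simp: centralizer_def)
    then have "commutator u v = \<one>" using commutator_eq_one_iff that Uc Vc by blast
    then show ?thesis using subgroup.one_closed[OF subgroup_center] by simp
  qed
  \<comment> \<open>Two extensions, one per factor: first from \<open>U\<close> to UA = G with
    \<open>v\<close> fixed, then from \<open>V\<close> to VA = G with \<open>x\<close>
    fixed.\<close>
  have xv: "commutator x v \<in> ?Z" if "x \<in> carrier G" "v \<in> V" for x v
    using mod[OF _ U UA, of v] uv that Vc by (auto simp: centralizer_mod_def)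
  have xy: "commutator y x \<in> ?Z" if x: "x \<in> carrier G" and y: "y \<in> carrier G" for x y
  proof -
    have "commutator v x \<in> ?Z" if "v \<in> V" for v
      using xv[OF x that] commutator_mem_sym[OF center_normal x] that Vc by blast
    then show ?thesis using mod[OF x V(1) VA] y by (auto simp: centralizer_mod_def)
  qed
  then show ?thesis by (simp add: derived_subset_iff subgroup_center)
qed

lemma measure_cases:
  assumes U: "subgroup U G"
  shows "CD_measure G U \<le> p ^ 8"
    and "CD_measure G U = p ^ 8 \<Longrightarrow> U \<in> {center G, A, carrier G}"
proof -
  define V where "V = centralizer G U"
  let ?Z = "center G"
  have Uc: "U \<subseteq> carrier G" using U by (rule subgroup.subset)
  have V: "subgroup V G" using Uc by (simp add: V_def subgroup_centralizer)
  have Vc: "V \<subseteq> carrier G" using V by (rule subgroup.subset)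
  have UV: "U \<subseteq> centralizer G V" using centralizer_galois[OF Uc Vc] by (simp add: V_def)
  have m: "CD_measure G U = card U * card V" by (simp add: CD_measure_def V_def)
  \<comment> \<open>These products are the measures of \<open>A\<close>, of the whole group and of
    the centre.\<close>
  have p8: "p ^ 8 = p ^ 4 * p ^ 4" "p ^ 8 = p ^ 6 * p ^ 2" "p ^ 8 = p ^ 2 * p ^ 6" by (simp_all flip: power_add)
  have fA: "finite A" by (simp add: A.subgroup_axioms finite_subgroup)
  have fZ: "finite ?Z" by (simp add: finite_subgroup subgroup_center)
  have "CD_measure G U \<le> p ^ 8 \<and> (CD_measure G U = p ^ 8 \<longrightarrow> U \<in> {center G, A, carrier G})"
  proof -
    \<comment> \<open>A noncentral element of \<open>A\<close> in \<open>U\<close> forces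
      \<open>V\<close> into \<open>A\<close>, and conversely. If just one of the two meets
      \<open>A\<close> outside the centre, the other lies in \<open>A\<close> and hence in the
      centre.\<close>
    consider "V \<subseteq> ?Z" | "U \<subseteq> ?Z" | "U \<subseteq> A" "V \<subseteq> A"
      | "U \<inter> A \<subseteq> ?Z" "V \<inter> A \<subseteq> ?Z"
    proof -
      have "V \<subseteq> A" if "\<not> U \<inter> A \<subseteq> ?Z" using that centralizer_le_A[of _ U] by (auto simp: V_def)
      moreover have "U \<subseteq> A" if "\<not> V \<inter> A \<subseteq> ?Z"
        using that centralizer_le_A[of _ V] UV by blast
      ultimately show ?thesis using that by blast
    qed
    then show ?thesis
    proof cases
      case 1
      then have V2: "card V \<le> p ^ 2" using card_mono[OF fZ] card_center by metis
      have U6: "card U \<le> p ^ 6" using card_mono[OF finite_carrier Uc] card_carrier by simp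
      have "card U * card V \<le> p ^ 6 * p ^ 2" using U6 V2 by (rule mult_le_mono)
      moreover have "U = carrier G" if "card U * card V = p ^ 6 * p ^ 2"
      proof -
        have "p ^ 6 * p ^ 2 \<le> card U * p ^ 2" using that V2 by (metis mult_le_mono2)
        then have "p ^ 6 \<le> card U" by (simp only: power_cancel)
        then show ?thesis using card_seteq[OF finite_carrier Uc] card_carrier by simp
      qed
      ultimately show ?thesis unfolding m p8(2) by blast
    next
      case 2
      then have U2: "card U \<le> p ^ 2" using card_mono[OF fZ] card_center by metis
      have V6: "card V \<le> p ^ 6" using card_mono[OF finite_carrier Vc] card_carrier by simp
      have "card U * card V \<le> p ^ 2 * p ^ 6" using U2 V6 by (rule mult_le_mono)
      moreover have "U = ?Z" if "card U * card V = p ^ 2 * p ^ 6"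
      proof -
        have "p ^ 2 * p ^ 6 \<le> card U * p ^ 6" using that V6 by (metis mult_le_mono2)
        then have "p ^ 2 \<le> card U" by (simp only: power_cancel)
        then show ?thesis using card_seteq[OF fZ 2] card_center by simp
      qed
      ultimately show ?thesis unfolding m p8(3) by blast
    next
      case 3
      have U4: "card U \<le> p ^ 4" and V4: "card V \<le> p ^ 4"
        using card_mono[OF fA] 3 card_A by metis+
      have "card U * card V \<le> p ^ 4 * p ^ 4" using U4 V4 by (rule mult_le_mono)
      moreover have "U = A" if "card U * card V = p ^ 4 * p ^ 4"
      proof -
        have "p ^ 4 * p ^ 4 \<le> card U * p ^ 4" using that V4 by (metis mult_le_mono2)
        then have "p ^ 4 \<le> card U" by (simp only: power_cancel)
        then show ?thesis using card_seteq[OF fA 3(1)] card_A by simp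
      qed
      ultimately show ?thesis unfolding m p8(1) by blast
    next
      case 4
      note U4 = card_subgroup_off_A[OF U 4(1)] and V4 = card_subgroup_off_A[OF V 4(2)]
      have "card U * card V \<le> p ^ 4 * p ^ 4" using U4(1) V4(1) by (rule mult_le_mono)
      moreover have False if eq: "card U * card V = p ^ 4 * p ^ 4"
      proof -
        have "p ^ 4 * p ^ 4 \<le> card U * p ^ 4" using eq V4(1) by (metis mult_le_mono2)
        moreover have "p ^ 4 * p ^ 4 \<le> p ^ 4 * card V" using eq U4(1) by (metis mult_le_mono1)
        ultimately have "p ^ 4 \<le> card U" "p ^ 4 \<le> card V" by (simp_all only: power_cancel)
        then have "card U = p ^ 4" "card V = p ^ 4" using U4(1) V4(1) by simp_all
        then show False
          using derived_central_if_factors[OF U V] U4(2) V4(2) derived_not_central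
          by (simp add: V_def)
      qed
      ultimately show ?thesis unfolding m p8(1) by blast
    qed
  qed
  then show "CD_measure G U \<le> p ^ 8"
    and "CD_measure G U = p ^ 8 \<Longrightarrow> U \<in> {center G, A, carrier G}" by auto
qed

lemma max_CD_measure: "max_CD_measure G = p ^ 8"
  unfolding max_CD_measure_def
proof (rule Max_eqI)
  have "{U. subgroup U G} \<subseteq> Pow (carrier G)" by (auto dest: subgroup.subset)
  then have "finite {U. subgroup U G}" by (rule finite_subset) (simp add: finite_carrier)
  then show "finite {CD_measure G U |U. subgroup U G}" by simp
  have "CD_measure G A = p ^ 8"
    by (simp add: CD_measure_def centralizer_A card_A flip: power_add)
  then show "p ^ 8 \<in> {CD_measure G U |U. subgroup U G}"
    using A.subgroup_axioms by (metis (mono_tags, lifting) mem_Collect_eq)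
qed (use measure_cases(1) in auto)

lemma CD_lattice_eq: "CD_lattice G = {center G, A, carrier G}"
proof
  show "CD_lattice G \<subseteq> {center G, A, carrier G}"
    using measure_cases(2) by (auto simp: CD_lattice_def max_CD_measure)
  have "centralizer G (center G) = carrier G"
    by (simp add: centralizer_eq_carrier_iff subgroup.subset subgroup_center)
  then have "CD_measure G (center G) = p ^ 8" "CD_measure G (carrier G) = p ^ 8" "CD_measure G A = p ^ 8"
    by (simp_all add: CD_measure_def centralizer_A card_A card_carrier card_center
      flip: center_eq_centralizer power_add)
  then show "{center G, A, carrier G} \<subseteq> CD_lattice G"
    by (simp add: CD_lattice_def max_CD_measure subgroup_center subgroup_self A.subgroup_axioms)
qed

lemma chain: "chain_of_length G 2 (CD_lattice G)"
proof -
  define H where "H i = (if i = 0 then center G else if i = 1 then A else carrier G)" for i :: nat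
  have "p ^ 2 \<noteq> p ^ 4" using p_gt_1 by simp
  then have "center G \<noteq> A" using card_A card_center by metis
  then have "center G \<subset> A" using center_le_A by blast
  then have "\<forall>i<2. H i \<subset> H (Suc i)" using A_psubset by (auto simp: H_def)
  moreover have "\<forall>i\<le>2. subgroup (H i) G"
    by (simp add: H_def subgroup_center subgroup_self A.subgroup_axioms)
  moreover have "CD_lattice G = H ` {..2}"
  proof -
    have "{..2} = {0, 1, 2 :: nat}" by auto
    then show ?thesis by (auto simp: H_def CD_lattice_eq)
  qed
  ultimately show ?thesis unfolding chain_of_length_def by blast
qed

end

section \<open>Lattices with three members\<close>

text \<open>The situation inside the largest member M, where the centre is the bottom of the chain
  and the carrier its top. The order is only bounded, since M might a priori be smaller than P;
  \<open>balanced\<close> says that \<open>A\<close> and the carrier have the same measure.\<close>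

locale CD_three_group = finite_p_group +
  fixes A
  assumes k_le: "k \<le> 6"
    and A_subgroup: "subgroup A G" and A_centralizer: "centralizer G A = A"
    and center_psubset_A: "center G \<subset> A" and A_psubset: "A \<subset> carrier G"
    and balanced: "card A * card A = order G * card (center G)"
    and measure_le: "subgroup U G \<Longrightarrow> card U * card (centralizer G U) \<le> card A * card A"
    and measure_eq: "subgroup U G \<Longrightarrow> card U * card (centralizer G U) = card A * card A
      \<Longrightarrow> U \<in> {center G, A, carrier G}"
begin

lemma A_subset: "A \<subseteq> carrier G"
  using A_psubset by blast

lemma A_commute: "a \<in> A \<Longrightarrow> b \<in> A \<Longrightarrow> a \<otimes> b = b \<otimes> a"
  using A_centralizer by (auto simp: centralizer_def)

text \<open>An abelian subgroup lies in its own centralizer, so its measure is at least |D|^2 and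
  hence maximal. Of the three candidates the carrier is not abelian, and the other two lie in
  \<open>A\<close>.\<close>

lemma abelian_subset_A:
  assumes D: "subgroup D G" "D \<subseteq> centralizer G D" "card A \<le> card D"
  shows "D \<subseteq> A"
proof -
  have "card D \<le> card (centralizer G D)"
    using D by (intro card_mono finite_subgroup subgroup_centralizer) (auto dest: subgroup.subset)
  then have "card A * card A \<le> card D * card (centralizer G D)"
    using D(3) by (intro mult_le_mono) auto
  then have "D \<in> {center G, A, carrier G}"
    using measure_eq measure_le D(1) by (simp add: le_antisym)
  moreover have "D \<noteq> carrier G"
    using D(2) center_psubset_A A_psubset by (auto simp flip: center_eq_centralizer)
  ultimately show ?thesis using center_psubset_A by blast
qed

text \<open>Every conjugate of \<open>A\<close> is abelian of the same order.\<close>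

lemma A_normal: "A \<lhd> G"
proof -
  have "g \<otimes> a \<otimes> inv g \<in> A" if g: "g \<in> carrier G" and a: "a \<in> A" for g a
  proof -
    let ?c = "\<lambda>x. g \<otimes> x \<otimes> inv g"
    have "?c \<in> hom G G" using g by (auto simp: hom_def free_simps)
    then interpret c: group_hom G G ?c by unfold_locales
    have "subgroup (?c ` A) G" by (rule c.subgroup_img_is_subgroup[OF A_subgroup])
    moreover have "?c ` A \<subseteq> centralizer G (?c ` A)"
    proof -
      have "?c a \<otimes> ?c b = ?c b \<otimes> ?c a" if "a \<in> A" "b \<in> A" for a b
        using that A_subset A_commute[OF that] c.hom_mult[of a b] c.hom_mult[of b a]
        by (metis subsetD)
      then show ?thesis using A_subset g by (auto simp: centralizer_def)
    qed
    moreover have "card (?c ` A) = card A"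
    proof (rule card_image, rule inj_onI)
      fix x y assume "x \<in> A" "y \<in> A" "?c x = ?c y"
      then show "x = y" using g A_subset by (metis inv_closed l_cancel m_closed r_cancel subsetD)
    qed
    ultimately have "?c ` A \<subseteq> A" using abelian_subset_A by simp
    then show ?thesis using a by blast
  qed
  then show ?thesis using A_subgroup by (simp add: normal_inv_iff)
qed

sublocale A: normal A G by (rule A_normal)

section \<open>The orders of the three members\<close>

lemma noncentral_centralizer: "x \<in> carrier G \<Longrightarrow> x \<notin> center G \<Longrightarrow> centralizer G {x} \<subset> carrier G"
  using centralizer_eq_carrier_iff[of "{x}"] centralizer_subset[of "{x}"] by auto

lemma center_psubset_adjoin: "x \<notin> center G \<Longrightarrow> center G \<subset> adjoin {x}"
  using subset_adjoin by blast

lemma adjoin_singleton_abelian: "x \<in> carrier G \<Longrightarrow> adjoin {x} \<subseteq> centralizer G (adjoin {x})"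
  by (intro adjoin_abelian) (auto simp: centralizer_def)

text \<open>If \<open>A\<close> had order only p|Z|, then \<open>x\<close> outside \<open>A\<close>
  together with the centre would generate an abelian subgroup at least as large, which would have to
  lie in \<open>A\<close>.\<close>

lemma card_A_large: "p ^ 2 * card (center G) \<le> card A"
proof -
  obtain x where x: "x \<in> carrier G" "x \<notin> A" using A_psubset by blast
  have sub: "subgroup (adjoin {x}) G" using x by (simp add: subgroup_adjoin)
  have W: "p * card (center G) \<le> card (adjoin {x})"
    using psubgroup_card[OF subgroup_center sub] center_psubset_adjoin x center_psubset_A by blast
  obtain m z where mz: "card A = p ^ m" "card (center G) = p ^ z"
    using subgroup_card_power A_subgroup subgroup_center by metis
  have "z < m"
    using psubset_card_mono[OF finite_subgroup[OF A_subgroup] center_psubset_A] mz p_gt_1 by simp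
  moreover have "m \<noteq> Suc z"
  proof
    assume "m = Suc z"
    then have "card A \<le> card (adjoin {x})" using W mz by simp
    then have "adjoin {x} \<subseteq> A"
      using abelian_subset_A sub adjoin_singleton_abelian x by blast
    then show False using subset_adjoin(1)[of "{x}"] x by blast
  qed
  ultimately have "p ^ (2 + z) \<le> p ^ m" using p_gt_1 by (intro power_increasing) auto
  then show ?thesis by (simp only: mz power_add)
qed

text \<open>If the centralizer of \<open>x\<close> had index p, then \<open>adjoin {x}\<close> would
  have measure at least p|Z| times |G|/p, the maximum. It would be one of the three members, and its
  centralizer would be too small for index p.\<close>

lemma noncentral_class:
  assumes x: "x \<in> carrier G" "x \<notin> center G"
  shows "p ^ 2 * card (centralizer G {x}) \<le> order G"
proof -
  let ?W = "adjoin {x}"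
  have sub: "subgroup ?W G" using x by (simp add: subgroup_adjoin)
  have CW: "centralizer G ?W = centralizer G {x}" using x by (simp add: centralizer_adjoin)
  have subC: "subgroup (centralizer G {x}) G" using x by (simp add: subgroup_centralizer)
  obtain m z c where mz: "card A = p ^ m" "card (center G) = p ^ z" "card (centralizer G {x}) = p ^ c"
    using subgroup_card_power A_subgroup subgroup_center subC by metis
  have "p ^ (m + m) = p ^ (k + z)" using balanced mz order_eq by (simp add: power_add)
  then have mk: "m + m = k + z" using p_gt_1 by (simp only: power_inject_exp)
  have "p ^ (2 + z) \<le> p ^ m" using card_A_large mz by (simp only: power_add)
  then have m2: "2 + z \<le> m" using p_gt_1 power_increasing_iff by blast
  have "p ^ c < p ^ k"
    using psubset_card_mono[OF finite_carrier noncentral_centralizer[OF x]] mz order_eq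
    by (simp add: order_def)
  then have "c < k" using p_gt_1 by simp
  moreover have "k \<noteq> Suc c"
  proof
    assume kc: "k = Suc c"
    have "p * card (center G) \<le> card ?W"
      using psubgroup_card[OF subgroup_center sub] center_psubset_adjoin x by blast
    then have "p ^ Suc z * p ^ c \<le> card ?W * card (centralizer G ?W)"
      using mz CW by (intro mult_le_mono) auto
    moreover have "p ^ Suc z * p ^ c = card A * card A"
      using balanced mz order_eq kc by (simp add: mult_ac)
    ultimately have "?W \<in> {center G, A, carrier G}"
      using measure_eq[OF sub] measure_le[OF sub] by simp
    moreover have "?W \<noteq> center G" using subset_adjoin(1)[of "{x}"] x by blast
    ultimately have "centralizer G {x} = A \<or> centralizer G {x} = center G"
      using CW A_centralizer center_eq_centralizer by auto
    \<comment> \<open>With k = c + 1 and 2m = k + z, the first case gives m = z + 1 and the second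
      2m = 2z + 1; both contradict m >= z + 2.\<close>
    then have "c = m \<or> c = z" using mz p_gt_1 by (auto dest: power_inject_exp[THEN iffD1, OF p_gt_1])
    then show False using mk m2 kc by auto
  qed
  ultimately have "p ^ (2 + c) \<le> p ^ k" using p_gt_1 by (intro power_increasing) auto
  then show ?thesis by (simp only: mz power_add order_eq)
qed

text \<open>The class of \<open>x\<close> has as many elements as there are commutators with
  \<open>x\<close>, and these all lie in the centre.\<close>

lemma card_centralizer_ge:
  assumes "x \<in> carrier G" "\<And>g. g \<in> carrier G \<Longrightarrow> commutator g x \<in> center G"
  shows "order G \<le> card (center G) * card (centralizer G {x})"
proof -
  have "card ((\<lambda>g. commutator g x) ` carrier G) \<le> card (center G)"
    using assms by (intro card_mono finite_subgroup subgroup_center) auto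
  moreover have "carrier G \<inter> centralizer G {x} = centralizer G {x}" using centralizer_subset by blast
  ultimately show ?thesis
    using card_commutators_times_centralizer[OF finite_carrier subgroup_self assms(1)]
    by (metis mult_le_mono1 order_def)
qed

lemma central_mod_center:
  obtains b where "b \<in> A - center G" "\<And>g. g \<in> carrier G \<Longrightarrow> commutator g b \<in> center G"
proof -
  obtain b where b: "b \<in> A - center G" "\<And>g. g \<in> carrier G \<Longrightarrow> commutator b g \<in> center G"
    using exists_central_mod[OF center_normal A_normal center_psubset_A] by blast
  then have "commutator g b \<in> center G" if "g \<in> carrier G" for g
    using that commutator_mem_sym[OF center_normal, of b g] A_subset by blast
  then show ?thesis using that b(1) by blast
qed

lemma cards: "k = 6" "card A = p ^ 4" "card (center G) = p ^ 2"
proof -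
  obtain b where b: "b \<in> A - center G" "\<And>g. g \<in> carrier G \<Longrightarrow> commutator g b \<in> center G"
    using central_mod_center by blast
  have bc: "b \<in> carrier G" "b \<notin> center G" using b A_subset by auto
  \<comment> \<open>The class of \<open>b\<close> has at least p^2 elements because \<open>b\<close>
    is noncentral, and at most |Z| because \<open>b\<close> is central modulo the centre.\<close>
  have "p ^ 2 * card (centralizer G {b}) \<le> card (center G) * card (centralizer G {b})"
    using noncentral_class[OF bc] card_centralizer_ge[OF bc(1) b(2)] by linarith
  moreover have "0 < card (centralizer G {b})"
    using bc by (simp add: subgroup_card_pos subgroup_centralizer)
  ultimately have pz: "p ^ 2 \<le> card (center G)" by simp
  obtain m z where mz: "card A = p ^ m" "card (center G) = p ^ z"
    using subgroup_card_power A_subgroup subgroup_center by metis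
  have "p ^ (m + m) = p ^ (k + z)" using balanced mz order_eq by (simp add: power_add)
  then have mk: "m + m = k + z" using p_gt_1 by (simp only: power_inject_exp)
  have "p ^ (2 + z) \<le> p ^ m" using card_A_large mz by (simp only: power_add)
  then have m2: "2 + z \<le> m" using p_gt_1 power_increasing_iff by blast
  have z2: "2 \<le> z" using pz mz p_gt_1 by simp
  have "k = 6 \<and> m = 4 \<and> z = 2" using mk m2 z2 k_le by linarith
  then show "k = 6" "card A = p ^ 4" "card (center G) = p ^ 2" using mz by simp_all
qed

lemma card_carrier: "card (carrier G) = p ^ 6"
  using order_eq cards(1) by (simp add: order_def)

section \<open>Commutators with elements of \<open>A\<close>\<close>

lemma centralizer_in_A:
  assumes "a \<in> A" "a \<notin> center G" shows "centralizer G {a} = A"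
proof -
  have ac: "a \<in> carrier G" using assms A_subset by blast
  have "p ^ 2 * card (centralizer G {a}) \<le> p ^ 2 * p ^ 4"
    using noncentral_class[OF ac assms(2)] card_carrier by (simp add: order_def flip: power_add)
  then have "card (centralizer G {a}) \<le> card A" by (simp only: power_cancel cards(2))
  moreover have "A \<subseteq> centralizer G {a}"
    using A_commute assms A_subset by (auto simp: centralizer_def)
  ultimately have "A = centralizer G {a}"
    using card_seteq[of "centralizer G {a}" A] ac by (simp add: finite_subgroup subgroup_centralizer)
  then show ?thesis by simp
qed

lemma commuting_outside:
  assumes "x \<in> carrier G" "x \<notin> A" "a \<in> A" "a \<otimes> x = x \<otimes> a"
  shows "a \<in> center G"
proof (rule ccontr)
  assume "a \<notin> center G"
  then have "centralizer G {a} = A" using centralizer_in_A assms by blast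
  moreover have "x \<in> centralizer G {a}" using assms by (simp add: centralizer_def)
  ultimately show False using assms by blast
qed

text \<open>For $b$ central modulo the centre, $g \mapsto [g, b]$ is a homomorphism to an abelian group
  with kernel $A$.\<close>

lemma derived_le_A: "derived G (carrier G) \<subseteq> A"
proof -
  obtain b where b: "b \<in> A - center G" "\<And>g. g \<in> carrier G \<Longrightarrow> commutator g b \<in> center G"
    using central_mod_center by blast
  have bc: "b \<in> carrier G" using b A_subset by auto
  have "commutator x y \<in> A" if xy: "x \<in> carrier G" "y \<in> carrier G" for x y
  proof -
    \<comment> \<open>Inverses are taken so that the quotient of \<open>?h \<otimes> ?g\<close> and
      \<open>?g \<otimes> ?h\<close> below is exactly the commutator of \<open>x\<close> and
      \<open>y\<close>.\<close>
    let ?g = "inv x" and ?h = "inv y"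
    have gh: "?g \<in> carrier G" "?h \<in> carrier G" using xy by auto
    have "commutator (?h \<otimes> ?g) b = commutator ?h b \<otimes> commutator ?g b"
      using gh bc b(2) by (intro commutator_mult_left) auto
    also have "\<dots> = commutator ?g b \<otimes> commutator ?h b"
      using b(2)[OF gh(2)] gh bc by (simp add: center_def)
    also have "\<dots> = commutator (?g \<otimes> ?h) b"
      using gh bc b(2) by (intro commutator_mult_left[symmetric]) auto
    finally have "inv (?h \<otimes> ?g) \<otimes> (?g \<otimes> ?h) \<otimes> b = b \<otimes> (inv (?h \<otimes> ?g) \<otimes> (?g \<otimes> ?h))"
      using commutator_eq_iff[of "?h \<otimes> ?g" "?g \<otimes> ?h" b] gh bc by blast
    moreover have "inv (?h \<otimes> ?g) \<otimes> (?g \<otimes> ?h) = commutator x y"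
      using xy by (simp add: free_simps)
    ultimately have "commutator x y \<in> centralizer G {b}" using xy by (simp add: centralizer_def)
    then show ?thesis using centralizer_in_A[of b] b(1) by blast
  qed
  then show ?thesis by (simp add: derived_subset_iff A_subgroup)
qed

text \<open>Since $P' \leq A$, the conjugation actions of $x$ and $y$ on $A$ commute. Choosing $y \notin A$
  with $[a, y]$ central forces $[a, x]$ to commute with $y$.\<close>

lemma commutator_central:
  assumes a: "a \<in> A" and x: "x \<in> carrier G"
  shows "commutator x a \<in> center G"
proof (cases "a \<in> center G")
  case True
  then have "commutator x a = \<one>" using x commutator_eq_one_iff[of x a] by (auto simp: center_def)
  then show ?thesis using subgroup.one_closed[OF subgroup_center] by simp
next
  case False
  have ac: "a \<in> carrier G" using a A_subset by blast
  \<comment> \<open>The coset of \<open>a\<close> has fewer than |A/Z| = p^2 conjugates in P/Z, so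
    its stabilizer has order above p^4 = |A| and contains some \<open>y\<close> outside
    \<open>A\<close>.\<close>
  have "p ^ 6 * p ^ 2 < card (centralizer_mod (center G) {a}) * p ^ 4"
    using centralizer_mod_large[OF finite_carrier center_normal A_normal, of a] a False
      center_psubset_A card_carrier cards by (auto simp: order_def)
  moreover have "p ^ 6 * p ^ 2 = p ^ 4 * p ^ 4" by (simp flip: power_add)
  ultimately have "p ^ 4 < card (centralizer_mod (center G) {a})" by (metis mult_less_cancel2)
  then have "\<not> centralizer_mod (center G) {a} \<subseteq> A"
    using card_mono[OF finite_subgroup[OF A_subgroup]] cards(2) by (metis not_less)
  then obtain y where y: "y \<in> carrier G" "y \<notin> A" "commutator y a \<in> center G"
    by (auto simp: centralizer_mod_def)
  define w where "w = commutator x a"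
  define z where "z = commutator y a"
  have zc: "z \<in> carrier G" "\<And>g. g \<in> carrier G \<Longrightarrow> z \<otimes> g = g \<otimes> z"
    using y by (auto simp: z_def center_def)
  have wA: "w \<in> A"
    using a x A.inv_op_closed2[OF x a] by (simp add: w_def A.m_closed)
  have wc: "w \<in> carrier G" using wA A_subset by blast
  have xa: "x \<otimes> a \<otimes> inv x = w \<otimes> a" and ya: "y \<otimes> a \<otimes> inv y = z \<otimes> a"
    using x y(1) ac by (simp_all add: w_def z_def free_simps)
  \<comment> \<open>The words xy and yx differ by an element of P', which lies in \<open>A\<close>
    and so commutes with \<open>a\<close>; they conjugate \<open>a\<close> alike.\<close>
  have "inv (y \<otimes> x) \<otimes> (x \<otimes> y) = commutator (inv x) (inv y)" using x y(1) by (simp add: free_simps)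
  also have "\<dots> \<in> A"
    using derived_le_A derived_subset_iff[OF A_subgroup] x y(1) inv_closed by blast
  finally have "inv (y \<otimes> x) \<otimes> (x \<otimes> y) \<in> A" .
  then have "(y \<otimes> x) \<otimes> a \<otimes> inv (y \<otimes> x) = (x \<otimes> y) \<otimes> a \<otimes> inv (x \<otimes> y)"
    using conj_eq_iff[of "y \<otimes> x" "x \<otimes> y" a] x y(1) ac A_commute[OF _ a] by simp
  moreover have "(y \<otimes> x) \<otimes> a \<otimes> inv (y \<otimes> x) = y \<otimes> (x \<otimes> a \<otimes> inv x) \<otimes> inv y"
    using x y(1) ac by (simp add: free_simps)
  moreover have "(x \<otimes> y) \<otimes> a \<otimes> inv (x \<otimes> y) = x \<otimes> (y \<otimes> a \<otimes> inv y) \<otimes> inv x"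
    using x y(1) ac by (simp add: free_simps)
  ultimately have "y \<otimes> (w \<otimes> a) \<otimes> inv y = x \<otimes> (z \<otimes> a) \<otimes> inv x" by (simp only: xa ya)
  also have "\<dots> = (x \<otimes> z) \<otimes> (a \<otimes> inv x)" using x ac zc(1) by (simp add: m_assoc)
  also have "\<dots> = (z \<otimes> x) \<otimes> (a \<otimes> inv x)" by (simp only: zc(2)[OF x])
  also have "\<dots> = z \<otimes> (x \<otimes> a \<otimes> inv x)" using x ac zc(1) by (simp add: m_assoc)
  also have "\<dots> = (z \<otimes> w) \<otimes> a" using wc ac zc(1) by (simp add: xa m_assoc)
  also have "\<dots> = w \<otimes> (z \<otimes> a)" using wc ac zc(1) by (simp add: zc(2)[OF wc] m_assoc)
  finally have "y \<otimes> (w \<otimes> a) \<otimes> inv y = w \<otimes> (z \<otimes> a)" .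
  moreover have "y \<otimes> (w \<otimes> a) \<otimes> inv y = (y \<otimes> w \<otimes> inv y) \<otimes> (y \<otimes> a \<otimes> inv y)"
    using y(1) wc ac by (simp add: free_simps)
  ultimately have "(y \<otimes> w \<otimes> inv y) \<otimes> (z \<otimes> a) = w \<otimes> (z \<otimes> a)" by (simp only: ya)
  then have "y \<otimes> w \<otimes> inv y = w" using y(1) wc ac zc(1) by simp
  then have "w \<otimes> y = y \<otimes> w" using y(1) wc by (metis inv_closed inv_solve_right m_closed)
  then show ?thesis using commuting_outside[OF y(1,2) wA] by (simp add: w_def)
qed

lemma commutator_central':
  assumes a: "a \<in> A" and x: "x \<in> carrier G"
  shows "commutator a x \<in> center G"
  using commutator_central[OF assms] commutator_mem_sym[OF center_normal x] a A_subset by blast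

text \<open>The commutators lie in the centre, and the fibres of the map from \<open>A\<close> have
  at most |Z| = p^2 elements, so there are at least p^2 values: they fill the centre.\<close>

lemma commutator_elt_A:
  assumes x: "x \<in> carrier G" "x \<notin> A"
  shows "commutator_elt G A x = center G"
proof -
  let ?B = "(\<lambda>a. commutator a x) ` A"
  have sub: "?B \<subseteq> center G" using commutator_central' x by blast
  have fZ: "finite (center G)" by (simp add: finite_subgroup subgroup_center)
  have "A \<inter> centralizer G {x} \<subseteq> center G"
    using commuting_outside[OF x] by (auto simp: centralizer_def)
  then have "card (A \<inter> centralizer G {x}) \<le> p ^ 2" using card_mono[OF fZ] cards(3) by metis
  then have "card ?B * card (A \<inter> centralizer G {x}) \<le> card ?B * p ^ 2" by (rule mult_le_mono2)
  then have "p ^ 2 * p ^ 2 \<le> card ?B * p ^ 2"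
    using card_commutators_times_centralizer[OF finite_carrier A_subgroup x(1)] cards(2)
    by (simp flip: power_add)
  then have "card (center G) \<le> card ?B" by (simp only: power_cancel cards(3))
  then have "?B = center G" using card_seteq[OF fZ sub] by simp
  then show ?thesis by (simp add: commutator_elt_eq generate_subgroup subgroup_center)
qed

lemma central_commutator_subgroup_A: "central_commutator_subgroup G p A"
  unfolding central_commutator_subgroup_def
proof (intro conjI ballI)
  interpret GA: group "G\<lparr>carrier := A\<rparr>" by (simp add: A_subgroup subgroup_imp_group)
  show "comm_group (G\<lparr>carrier := A\<rparr>)"
    using A_commute by (intro GA.group_comm_groupI) simp
  show "A \<lhd> G" by (rule A_normal)
  show "card A = p ^ 4" by (rule cards)
  show "commutator_elt G A x = center G" if "x \<in> carrier G - A" for x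
    using commutator_elt_A that by blast
qed

section \<open>The commutator subgroup and the parity of p\<close>

text \<open>In class two every $x \notin A$ would lie in an abelian subgroup of order at least $p^4$.\<close>

lemma derived_not_central: "\<not> derived G (carrier G) \<subseteq> center G"
proof
  assume "derived G (carrier G) \<subseteq> center G"
  then have comm: "commutator g x \<in> center G" if "g \<in> carrier G" "x \<in> carrier G" for g x
    using that by (simp add: derived_subset_iff subgroup_center)
  obtain x where x: "x \<in> carrier G" "x \<notin> A" using A_psubset by blast
  have "p ^ 2 * p ^ 4 \<le> p ^ 2 * card (centralizer G {x})"
    using card_centralizer_ge[of x] comm x card_carrier cards
    by (simp add: order_def flip: power_add)
  then have C4: "card A \<le> card (centralizer G {x})" by (simp only: power_cancel cards)
  have no: False if "D \<subseteq> carrier G" "D \<subseteq> centralizer G D" "x \<in> D" "card A \<le> card (adjoin D)" for D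
    using abelian_subset_A[OF subgroup_adjoin[OF that(1)] adjoin_abelian[OF that(1,2)] that(4)]
      subset_adjoin(1)[of D] that(3) x(2) by blast
  have sub: "subgroup (adjoin {x}) G" using x by (simp add: subgroup_adjoin)
  show False
  \<comment> \<open>Either the centralizer of \<open>x\<close>, of order at least p^4, already lies
    in the abelian \<open>adjoin {x}\<close>, or some \<open>y\<close> commuting with
    \<open>x\<close> enlarges it once more, to order at least p * p * p^2.\<close>
  proof (cases "centralizer G {x} \<subseteq> adjoin {x}")
    case True
    then have "card A \<le> card (adjoin {x})"
      using C4 card_mono[OF finite_subgroup[OF sub]] by (metis order_trans)
    then show False using no[of "{x}"] x(1) by (auto simp: centralizer_def)
  next
    case False
    then obtain y where y: "y \<in> carrier G" "y \<otimes> x = x \<otimes> y" "y \<notin> adjoin {x}"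
      by (auto simp: centralizer_def)
    have sub': "subgroup (adjoin {x, y}) G" using x y by (simp add: subgroup_adjoin)
    have "p * card (center G) \<le> card (adjoin {x})"
      using psubgroup_card[OF subgroup_center sub] center_psubset_adjoin x center_psubset_A by blast
    moreover have "p * card (adjoin {x}) \<le> card (adjoin {x, y})"
      using psubgroup_card[OF sub sub'] adjoin_mono[of "{x}" "{x, y}"] subset_adjoin(1)[of "{x, y}"] y(3)
      by blast
    ultimately have "p * (p * p ^ 2) \<le> card (adjoin {x, y})"
      using cards(3) mult_le_mono2 order_trans by metis
    then have "card A \<le> card (adjoin {x, y})" using cards(2) by (simp add: eval_nat_numeral)
    then show False using no[of "{x, y}"] x(1) y(1,2) by (auto simp: centralizer_def)
  qed
qed

text \<open>For $p = 2$ every square would be central, so that $P / Z(P)$ would be abelian.\<close>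

lemma p_odd: "p \<noteq> 2"
proof
  assume p2: "p = 2"
  let ?Z = "center G"
  \<comment> \<open>If the square of a noncentral \<open>b\<close> is not central, it serves
    instead: the commutator of b^4 with \<open>x\<close> is the fourth power of [b, x], trivial
    because the centre has order 4.\<close>
  obtain b where b: "b \<in> A" "b \<notin> ?Z" "b \<otimes> b \<in> ?Z"
  proof -
    obtain b where b: "b \<in> A" "b \<notin> ?Z" using center_psubset_A by blast
    show ?thesis
    proof (cases "b \<otimes> b \<in> ?Z")
      case True
      then show ?thesis using that b by blast
    next
      case False
      obtain x where x: "x \<in> carrier G" "x \<notin> A" using A_psubset by blast
      have bc: "b \<in> carrier G" using b A_subset by blast
      have bb: "b \<otimes> b \<in> A" using b by (simp add: A.m_closed)
      define u where "u = commutator b x"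
      have u: "u \<in> ?Z" using commutator_central' b x by (simp add: u_def)
      have uc: "u \<in> carrier G" using u center_subset by blast
      interpret Z: group "G\<lparr>carrier := ?Z\<rparr>" by (simp add: subgroup_center subgroup_imp_group)
      have "u [^]\<^bsub>G\<lparr>carrier := ?Z\<rparr>\<^esub> (4 :: nat) = \<one>"
        using Z.pow_order_eq_1[of u] u cards(3) p2 by (simp add: order_def)
      then have "u \<otimes> u \<otimes> (u \<otimes> u) = \<one>"
        using uc by (simp add: eval_nat_numeral m_assoc)
      moreover have "commutator (b \<otimes> b) x = u \<otimes> u"
        using commutator_mult_left[of b b x] u bc x by (simp add: u_def)
      moreover have "commutator (b \<otimes> b \<otimes> (b \<otimes> b)) x = commutator (b \<otimes> b) x \<otimes> commutator (b \<otimes> b) x"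
        using commutator_central'[OF bb x(1)] bc x by (intro commutator_mult_left) auto
      ultimately have "commutator (b \<otimes> b \<otimes> (b \<otimes> b)) x = \<one>" by simp
      then have "b \<otimes> b \<otimes> (b \<otimes> b) \<in> ?Z"
        using commuting_outside[OF x] bb bc x commutator_eq_one_iff[of "b \<otimes> b \<otimes> (b \<otimes> b)" x]
        by (simp add: A.m_closed)
      then show ?thesis using that[OF bb False] by blast
    qed
  qed
  have bc: "b \<in> carrier G" using b A_subset by blast
  \<comment> \<open>Since b^2 is central, [b, x] has trivial square, so x^2 commutes with
    \<open>b\<close> and lies in \<open>A\<close>. It also commutes with \<open>x\<close>, which is
    outside \<open>A\<close>, so it is central.\<close>
  have out: "x \<otimes> x \<in> ?Z" if x: "x \<in> carrier G" "x \<notin> A" for x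
  proof -
    have "\<one> = commutator (b \<otimes> b) x"
      using b(3) x commutator_eq_one_iff[of "b \<otimes> b" x] bc by (simp add: center_def)
    also have "\<dots> = commutator b x \<otimes> commutator b x"
      using commutator_central'[OF b(1) x(1)] bc x by (intro commutator_mult_left) auto
    finally have "inv (commutator b x \<otimes> commutator b x) = \<one>" using inv_one by metis
    then have "commutator x b \<otimes> commutator x b = \<one>"
      using inv_mult_group[of "commutator b x" "commutator b x"] inv_commutator[OF bc x(1)] bc x by simp
    moreover have "commutator (x \<otimes> x) b = commutator x b \<otimes> commutator x b"
      using commutator_central[OF b(1) x(1)] bc x by (intro commutator_mult_left) auto
    ultimately have "x \<otimes> x \<in> centralizer G {b}"
      using commutator_eq_one_iff[of "x \<otimes> x" b] bc x by (simp add: centralizer_def)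
    then have "x \<otimes> x \<in> A" using centralizer_in_A b by blast
    then show ?thesis using commuting_outside[OF x] x by (simp add: m_assoc)
  qed
  interpret Z: subgroup ?Z G by (rule subgroup_center)
  \<comment> \<open>For \<open>g\<close> in \<open>A\<close>, both \<open>x\<close> and
    \<open>x \<otimes> g\<close> lie outside \<open>A\<close>, and modulo the centre the square of
    the latter is the product of the squares of \<open>x\<close> and \<open>g\<close>.\<close>
  have sq: "g \<otimes> g \<in> ?Z" if g: "g \<in> carrier G" for g
  proof (cases "g \<in> A")
    case True
    obtain x where x: "x \<in> carrier G" "x \<notin> A" using A_psubset by blast
    have "x \<otimes> g \<notin> A"
    proof
      assume "x \<otimes> g \<in> A"
      then have "x \<otimes> g \<otimes> inv g \<in> A" using A.m_closed[OF _ A.m_inv_closed[OF True]] by blast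
      moreover have "x \<otimes> g \<otimes> inv g = x" using x(1) g by (simp add: free_simps)
      ultimately show False using x(2) by metis
    qed
    then have 1: "(x \<otimes> g) \<otimes> (x \<otimes> g) \<in> ?Z" using out[of "x \<otimes> g"] x g by simp
    have 2: "x \<otimes> x \<in> ?Z" using out x by blast
    define z where "z = commutator g x"
    have z: "z \<in> ?Z" "z \<in> carrier G" using commutator_central'[OF True x(1)] x g by (simp_all add: z_def)
    have "(x \<otimes> g) \<otimes> (x \<otimes> g) = x \<otimes> z \<otimes> x \<otimes> (g \<otimes> g)"
      using x g by (simp add: z_def free_simps)
    also have "\<dots> = z \<otimes> (x \<otimes> x) \<otimes> (g \<otimes> g)"
    proof -
      have "x \<otimes> z = z \<otimes> x" using z(1) x(1) unfolding center_def by auto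
      then show ?thesis using z(2) x g by (simp add: m_assoc)
    qed
    finally have "g \<otimes> g = inv (z \<otimes> (x \<otimes> x)) \<otimes> ((x \<otimes> g) \<otimes> (x \<otimes> g))"
      using z(2) x g by (simp only: inv_l_cancel m_closed)
    then show ?thesis using 1 2 z(1) by (simp only: Z.m_closed Z.m_inv_closed)
  qed (use out g in blast)
  have "commutator g h \<in> ?Z" if gh: "g \<in> carrier G" "h \<in> carrier G" for g h
  proof -
    \<comment> \<open>A commutator is a product of squares and an inverse square.\<close>
    have "commutator g h = (g \<otimes> g) \<otimes> ((inv g \<otimes> h) \<otimes> (inv g \<otimes> h)) \<otimes> inv (h \<otimes> h)"
      using gh by (simp add: free_simps)
    then show ?thesis using sq[OF gh(1)] sq[OF gh(2)] sq[of "inv g \<otimes> h"] gh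
      by (simp only: Z.m_closed Z.m_inv_closed m_closed inv_closed)
  qed
  then show False
    using derived_not_central by (simp add: derived_subset_iff subgroup_center)
qed

text \<open>Modulo the centre, the commutators $[g, x]$ with a fixed $x \notin A$ form a central subgroup
  of order at most $p$, and dividing by it makes both $x$ and $A$ central.\<close>

lemma card_derived_le: "card (derived G (carrier G)) \<le> p ^ 3"
proof -
  let ?Z = "center G"
  interpret Z: normal ?Z G by (rule center_normal)
  interpret Q: group "G Mod ?Z" by (rule Z.factorgroup_is_group)
  interpret h: group_hom G "G Mod ?Z" "\<lambda>x. ?Z #> x"
    using Z.r_coset_hom_Mod by unfold_locales
  obtain x where x: "x \<in> carrier G" "x \<notin> A" using A_psubset by blast
  define f where "f g = ?Z #> commutator g x" for g
  define M where "M = f ` carrier G"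
  define D where "D = centralizer_mod ?Z {x}"
  have f: "f g = Q.commutator (?Z #> g) (?Z #> x)" if "g \<in> carrier G" for g
    using that x by (simp add: f_def h.hom_mult h.hom_inv del: mult_FactGroup)
  have comm_A: "commutator g y \<in> A" if "g \<in> carrier G" "y \<in> carrier G" for g y
    using derived_le_A derived_subset_iff[OF A_subgroup] that by blast
  have central: "?Z #> a \<in> center (G Mod ?Z)" if a: "a \<in> A" for a
  proof -
    have ac: "a \<in> carrier G" using a A_subset by blast
    have "(?Z #> a) <#> (?Z #> g) = (?Z #> g) <#> (?Z #> a)" if "g \<in> carrier G" for g
      using commutator_mem_iff[OF center_normal ac that] commutator_central'[OF a that] by blast
    then have "\<forall>q\<in>carrier (G Mod ?Z). (?Z #> a) <#> q = q <#> (?Z #> a)"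
      by (simp add: carrier_FactGroup)
    then show ?thesis using h.hom_closed[OF ac] unfolding center_def mult_FactGroup by blast
  qed
  \<comment> \<open>The commutators lie in \<open>A\<close>, whose image is central in the quotient,
    so \<open>commutators_with_subgroup\<close> applies there.\<close>
  have subM: "subgroup M (G Mod ?Z)"
  proof -
    have "M = (\<lambda>q. Q.commutator q (?Z #> x)) ` carrier (G Mod ?Z)"
      unfolding M_def carrier_FactGroup image_image using f by (intro image_cong) auto
    moreover have "Q.commutator q (?Z #> x) \<in> center (G Mod ?Z)" if "q \<in> carrier (G Mod ?Z)" for q
    proof -
      obtain g where g: "g \<in> carrier G" "q = ?Z #> g" using \<open>q \<in> _\<close> by (auto simp: carrier_FactGroup)
      then show ?thesis using f[OF g(1)] central[OF comm_A[OF g(1) x(1)]] by (simp add: f_def)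
    qed
    ultimately show ?thesis
      by (simp only: Q.commutators_with_subgroup[OF Q.subgroup_self h.hom_closed[OF x(1)]])
  qed
  have subD: "subgroup D G" using x by (simp add: D_def subgroup_centralizer_mod center_normal)
  have AD: "A \<subset> D"
  proof -
    have "x \<in> D" using x subgroup.one_closed[OF subgroup_center]
      by (simp add: D_def centralizer_mod_def m_assoc)
    moreover have "A \<subseteq> D"
      using commutator_central' x A_subset by (auto simp: D_def centralizer_mod_def)
    ultimately show ?thesis using x(2) by blast
  qed
  \<comment> \<open>\<open>D\<close> contains \<open>A\<close> and also \<open>x\<close>, so it has
    index at most p; the values of \<open>f\<close> correspond to its cosets.\<close>
  have D5: "p * p ^ 4 \<le> card D" using psubgroup_card[OF A_subgroup subD AD] cards(2) by simp
  have "card M * card D = card (carrier G)" unfolding M_def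
  proof (rule card_image_times_subgroup[OF finite_carrier subgroup_self subD subgroup.subset[OF subD]])
    fix g l assume gl: "g \<in> carrier G" "l \<in> carrier G"
    have "f g = f l \<longleftrightarrow> (?Z #> (inv g \<otimes> l)) \<otimes>\<^bsub>G Mod ?Z\<^esub> (?Z #> x) = (?Z #> x) \<otimes>\<^bsub>G Mod ?Z\<^esub> (?Z #> (inv g \<otimes> l))"
      using gl x Q.commutator_eq_iff[of "?Z #> g" "?Z #> l" "?Z #> x"] h.hom_closed
      by (simp add: f h.hom_mult h.hom_inv del: mult_FactGroup)
    then show "f g = f l \<longleftrightarrow> inv g \<otimes> l \<in> D"
      unfolding D_def centralizer_mod_singleton[OF center_normal x(1)] using gl
      by (simp add: centralizer_def del: mult_FactGroup)
  qed
  then have "card M * (p * p ^ 4) \<le> p * (p * p ^ 4)"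
    using mult_le_mono2[OF D5, of "card M"] card_carrier by (simp add: eval_nat_numeral)
  then have M: "card M \<le> p" using p_gt_1 by simp
  define N where "N = {n \<in> carrier G. ?Z #> n \<in> M}"
  have subN: "subgroup N G" unfolding N_def by (rule h.subgroup_preimage[OF subM])
  have "?Z #> z \<in> M" if "z \<in> ?Z" for z
    using that subgroup.one_closed[OF subM] by (simp add: Z.rcos_const group_axioms)
  then have ZN: "?Z \<subseteq> N" using center_subset by (auto simp: N_def)
  have NA: "N \<subseteq> A"
  proof
    fix n assume n: "n \<in> N"
    then obtain g where g: "g \<in> carrier G" "?Z #> n = ?Z #> commutator g x"
      by (auto simp: N_def M_def f_def)
    let ?c = "commutator g x"
    have nc: "n \<in> carrier G" using n by (simp add: N_def)
    have cA: "?c \<in> A" using comm_A g x by blast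
    have cc: "?c \<in> carrier G" using g x by simp
    have "n \<otimes> inv ?c \<in> ?Z" using g(2) rcos_eq_iff[OF center_normal nc cc] by blast
    then have "n \<otimes> inv ?c \<otimes> ?c \<in> A"
      using A.m_closed[OF _ cA] center_psubset_A by (meson psubsetD)
    moreover have "n \<otimes> inv ?c \<otimes> ?c = n" using nc cc by (metis inv_solve_right inv_closed m_closed)
    ultimately show "n \<in> A" by metis
  qed
  \<comment> \<open>\<open>N\<close> lies between the centre and \<open>A\<close>, so commutators
    with its elements are central and stay in \<open>N\<close>.\<close>
  have normN: "N \<lhd> G"
  proof -
    have "g \<otimes> n \<otimes> inv g \<in> N" if g: "g \<in> carrier G" and n: "n \<in> N" for g n
    proof -
      have nc: "n \<in> carrier G" using n by (simp add: N_def)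
      have "commutator g n \<in> N" using commutator_central[OF _ g] n NA ZN by blast
      then have "commutator g n \<otimes> n \<in> N" using n by (rule subgroup.m_closed[OF subN])
      then show ?thesis using g nc by (simp add: free_simps)
    qed
    then show ?thesis using subN by (simp add: normal_inv_iff)
  qed
  have "card N = card ((\<lambda>n. ?Z #> n) ` N) * card ?Z"
    using card_cosets_in[OF center_normal subN ZN finite_subgroup[OF subN]] by simp
  also have "\<dots> \<le> p * card ?Z"
  proof (rule mult_le_mono1)
    have "card ((\<lambda>n. ?Z #> n) ` N) \<le> card M"
      using finite_carrier by (intro card_mono) (auto simp: N_def M_def)
    then show "card ((\<lambda>n. ?Z #> n) ` N) \<le> p" using M by simp
  qed
  also have "\<dots> = p ^ 3" using cards(3) by (simp add: eval_nat_numeral)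
  finally have cardN: "card N \<le> p ^ 3" .
  let ?Y = "centralizer_mod N (carrier G)"
  have subY: "subgroup ?Y G" by (simp add: subgroup_centralizer_mod normN)
  have "commutator g x \<in> N" if "g \<in> carrier G" for g
    using that x by (auto simp: N_def M_def f_def)
  then have "commutator x g \<in> N" if "g \<in> carrier G" for g
    using that commutator_mem_sym[OF normN x(1) that] by blast
  then have "x \<in> ?Y" using x by (simp add: centralizer_mod_def)
  moreover have "A \<subseteq> ?Y" using commutator_central' ZN A_subset by (auto simp: centralizer_mod_def)
  ultimately have "p * card A \<le> card ?Y" using psubgroup_card[OF A_subgroup subY] x(2) by blast
  then have "p * (p * p ^ 4) \<le> p * card ?Y" using cards(2) by simp
  then have "order G \<le> p * card ?Y" using card_carrier by (simp add: order_def eval_nat_numeral)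
  then have "derived G (carrier G) \<subseteq> N" by (rule derived_subset_if_centralizer_mod_large[OF normN])
  then have "card (derived G (carrier G)) \<le> card N"
    by (rule card_mono[OF finite_subgroup[OF subN]])
  then show ?thesis using cardN by simp
qed

text \<open>For the lower bound, P' contains [A, x] = Z properly.\<close>

lemma card_derived: "card (derived G (carrier G)) = p ^ 3"
proof -
  let ?D = "derived G (carrier G)"
  obtain x where x: "x \<in> carrier G" "x \<notin> A" using A_psubset by blast
  have subD: "subgroup ?D G" by (simp add: derived_is_subgroup)
  have "generate G ((\<lambda>a. commutator a x) ` A) \<subseteq> ?D"
    using x A_subset by (intro generate_subgroup_incl subD) (use derived_subset_iff[OF subD] in auto)
  then have "center G \<subseteq> ?D" using commutator_elt_A[OF x] by (simp add: commutator_elt_eq)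
  then have "p * card (center G) \<le> card ?D"
    using psubgroup_card[OF subgroup_center subD] derived_not_central by blast
  then show ?thesis using card_derived_le cards(3) by (simp add: eval_nat_numeral)
qed

end

section \<open>From a chain to the largest member\<close>

context finite_p_group
begin

lemma CD_measure_le:
  assumes "subgroup U G" shows "CD_measure G U \<le> max_CD_measure G"
proof -
  have "{U. subgroup U G} \<subseteq> Pow (carrier G)" by (auto dest: subgroup.subset)
  then have "finite {U. subgroup U G}" by (rule finite_subset) (simp add: finite_carrier)
  then show ?thesis unfolding max_CD_measure_def using assms by (intro Max_ge) auto
qed

text \<open>Maximality at C(U) gives |C(U)||C(C(U))| <= |U||C(U)|, so the double centralizer is no
  larger than \<open>U\<close>, which it contains.\<close>

lemma CD_lattice_centralizer:
  assumes U: "U \<in> CD_lattice G"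
  shows "centralizer G U \<in> CD_lattice G" and "centralizer G (centralizer G U) = U"
proof -
  let ?C = "centralizer G U" and ?CC = "centralizer G (centralizer G U)"
  have sub: "subgroup U G" and m: "CD_measure G U = max_CD_measure G"
    using U by (auto simp: CD_lattice_def)
  have Uc: "U \<subseteq> carrier G" using sub by (rule subgroup.subset)
  have subC: "subgroup ?C G" using Uc by (rule subgroup_centralizer)
  have UCC: "U \<subseteq> ?CC" using centralizer_galois[OF Uc centralizer_subset] by blast
  have finCC: "finite ?CC" by (simp add: finite_subgroup subgroup_centralizer centralizer_subset)
  have le: "card ?C * card ?CC \<le> card ?C * card U"
    using CD_measure_le[OF subC] m by (simp add: CD_measure_def mult.commute)
  then have "card ?CC \<le> card U" using subgroup_card_pos[OF subC] by simp
  then show CC: "?CC = U" using card_seteq[OF finCC UCC] by simp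
  then show "?C \<in> CD_lattice G"
    using subC m by (simp add: CD_lattice_def CD_measure_def mult.commute)
qed

lemma CD_three_group_if_chain:
  assumes k: "k \<le> 6" and chain: "chain_of_length G 2 (CD_lattice G)"
  obtains A where "CD_three_group G p k A"
proof -
  let ?C = "centralizer G"
  obtain H where H: "\<forall>i\<le>2. subgroup (H i) G" "\<forall>i<2. H i \<subset> H (Suc i)" "CD_lattice G = H ` {..2}"
    using chain unfolding chain_of_length_def by blast
  define B A M where "B = H 0" and "A = H 1" and "M = H 2"
  have "{..2} = {0, 1, 2 :: nat}" by auto
  then have CD: "CD_lattice G = {B, A, M}" using H(3) by (auto simp: A_def B_def M_def)
  have "B \<subset> A" "A \<subset> M"
    using H(2)[rule_format, of 0] H(2)[rule_format, of 1]
    by (simp_all add: A_def B_def M_def eval_nat_numeral)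
  note lt = this
  have anti: "?C V \<subset> ?C U" if "U \<in> CD_lattice G" "V \<in> CD_lattice G" "U \<subset> V" for U V
  proof -
    have "?C V \<subseteq> ?C U" using \<open>U \<subset> V\<close> by (auto simp: centralizer_def)
    moreover have "?C V \<noteq> ?C U"
      using CD_lattice_centralizer(2)[OF that(1)] CD_lattice_centralizer(2)[OF that(2)] \<open>U \<subset> V\<close> by auto
    ultimately show ?thesis by blast
  qed
  have in3: "?C B \<in> {B, A, M}" "?C A \<in> {B, A, M}" "?C M \<in> {B, A, M}"
    using CD_lattice_centralizer(1) CD by auto
  have "?C M \<subset> ?C A" "?C A \<subset> ?C B" using anti lt CD by auto
  \<comment> \<open>A strictly decreasing triple inside a strictly increasing chain of three members
    can only be that chain reversed.\<close>
  then have C: "?C A = A" "?C M = B" using in3 lt by auto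
  have subs: "subgroup B G" "subgroup A G" "subgroup M G"
    using H(1) by (simp_all add: A_def B_def M_def)
  have max: "max_CD_measure G = card A * card A"
  proof -
    have "A \<in> CD_lattice G" using CD by blast
    then show ?thesis using C(1) by (simp add: CD_lattice_def CD_measure_def)
  qed
  have maxM: "card M * card B = card A * card A"
  proof -
    have "M \<in> CD_lattice G" using CD by blast
    then show ?thesis using C(2) max by (simp add: CD_lattice_def CD_measure_def)
  qed
  let ?M = "G\<lparr>carrier := M\<rparr>"
  have cent: "centralizer ?M U = M \<inter> ?C U" for U
    using subgroup.subset[OF subs(3)] by (auto simp: centralizer_def)
  have Z: "center ?M = B"
  proof -
    have "center ?M = M \<inter> ?C M"
      using subgroup.subset[OF subs(3)] by (auto simp: centralizer_def center_def)
    then show ?thesis using C lt by blast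
  qed
  obtain j where j: "j \<le> k" "card M = p ^ j" using subgroup_card_power[OF subs(3)] by metis
  interpret M: group ?M using subs by (simp add: subgroup_imp_group)
  \<comment> \<open>Centralizers shrink on passing to \<open>M\<close>, so measures do not grow; a
    subgroup of \<open>M\<close> that reaches the maximum there reaches it in the whole
    group.\<close>
  have le: "card U * card (centralizer ?M U) \<le> card U * card (?C U)" if "subgroup U G" for U
    unfolding cent using that
    by (intro mult_le_mono2 card_mono finite_subgroup subgroup_centralizer) (auto dest: subgroup.subset)
  have three: "CD_three_group ?M p j A"
  proof (intro CD_three_group.intro CD_three_group_axioms.intro finite_p_group.intro
      finite_p_group_axioms.intro)
    show "group ?M" by (rule M.group_axioms)
    show "Factorial_Ring.prime p" by (rule prime)
    show "order ?M = p ^ j" using j by (simp add: order_def)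
    show "j \<le> 6" using j k by simp
    show "subgroup A ?M" using subs lt by (simp add: subgroup_incl)
    show "centralizer ?M A = A" using cent C lt by auto
    show "center ?M \<subset> A" using Z lt by simp
    show "A \<subset> carrier ?M" using lt by simp
    show "card A * card A = order ?M * card (center ?M)" using maxM Z by (simp add: order_def)
    fix U assume "subgroup U ?M"
    then have U: "subgroup U G" using incl_subgroup[OF subs(3)] by blast
    have "CD_measure G U \<le> card A * card A" using CD_measure_le[OF U] max by simp
    then show "card U * card (centralizer ?M U) \<le> card A * card A"
      using order_trans[OF le[OF U]] by (simp only: CD_measure_def)
    assume "card U * card (centralizer ?M U) = card A * card A"
    then have "card A * card A \<le> CD_measure G U"
      using le[OF U] by (simp only: CD_measure_def)
    then have "CD_measure G U = max_CD_measure G"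
      using CD_measure_le[OF U] max by simp
    then show "U \<in> {center ?M, A, carrier ?M}"
      using U CD Z by (simp add: CD_lattice_def set_eq_iff) blast
  qed
  \<comment> \<open>The order of \<open>M\<close> is already the largest allowed, so
    \<open>M\<close> is the whole group.\<close>
  then have j6: "j = 6" using CD_three_group.cards(1) by blast
  then have "k = 6" using j(1) k by simp
  then have "M = carrier G"
    using card_seteq[OF finite_carrier subgroup.subset[OF subs(3)]] j j6 order_eq
    by (simp add: order_def)
  then have "CD_three_group G p k A" using three j6 \<open>k = 6\<close> by simp
  then show ?thesis by (rule that)
qed

end

theorem proposition2p4:
  fixes P :: "('a, 'b) monoid_scheme" and p k :: nat
  assumes "group P" and "Factorial_Ring.prime p" and "order P = p ^ k" and "k \<le> 6"
  shows "(chain_of_length P 2 (CD_lattice P) \<longleftrightarrow>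
            p \<noteq> 2 \<and> order P = p ^ 6 \<and> card (center P) = p ^ 2 \<and>
            card (derived P (carrier P)) = p ^ 3 \<and> (\<exists>A. central_commutator_subgroup P p A)) \<and>
         (chain_of_length P 2 (CD_lattice P) \<longrightarrow>
            (\<forall>A. central_commutator_subgroup P p A \<longrightarrow> CD_lattice P = {center P, A, carrier P}))"
proof -
  interpret group P by fact
  interpret finite_p_group P p k using assms by unfold_locales
  have forward: "p \<noteq> 2 \<and> order P = p ^ 6 \<and> card (center P) = p ^ 2 \<and>
      card (derived P (carrier P)) = p ^ 3 \<and> (\<exists>A. central_commutator_subgroup P p A)"
    if chain: "chain_of_length P 2 (CD_lattice P)"
  proof -
    obtain A where "CD_three_group P p k A" by (rule CD_three_group_if_chain[OF assms(4) chain])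
    then interpret CD_three_group P p k A .
    show ?thesis
      using p_odd cards card_derived central_commutator_subgroup_A assms(3) by blast
  qed
  \<comment> \<open>Kept general in \<open>A\<close>: the final claim concerns every subgroup with
    the commutator property, not only the one supplied by the chain.\<close>
  have backward: "central_commutator_group P p k A"
    if "order P = p ^ 6" "card (center P) = p ^ 2" "card (derived P (carrier P)) = p ^ 3"
      "central_commutator_subgroup P p A" for A
  proof unfold_locales
    show "k = 6" using assms(3) that(1) p_gt_1 by simp
  qed (use that in auto)
  show ?thesis
    using forward backward central_commutator_group.chain central_commutator_group.CD_lattice_eq
    by blast
qed

end
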